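(* For all ordinals $\alpha$, $\beta$, $\gamma$, \[ \alpha^{\otimes(\beta\oplus\gamma)} = (\alpha^{\otimes\beta}) \otimes (\alpha^{\otimes\gamma}). \]
   Context: Every ordinal $\alpha$ has a unique Cantor normal form $\alpha=\omega^{\alpha_0}a_0+\dots+\omega^{\alpha_r}a_r$ with $\alpha_0>\dots>\alpha_r$ ordinals and $a_i$ positive integers. The natural (Hessenberg) sum $\alpha\oplus\beta$ is obtained by adding Cantor normal forms as polynomials in $\omega$: if $\alpha=\sum_i\omega^{\gamma_i}a_i$ and $\beta=\sum_i\omega^{\gamma_i}b_i$ (over a common decreasing list of exponents $\gamma_0>\dots>\gamma_r$, with whole-number coefficients), then $\alpha\oplus\beta=\sum_i\omega^{\gamma_i}(a_i+b_i)$. The natural product is $\alpha\otimes\beta=\bigoplus_{i,j}\omega^{\alpha_i\oplus\beta_j}a_ib_j$ where $\alpha=\sum_i\omega^{\alpha_i}a_i$, $\beta=\sum_j\omega^{\beta_j}b_j$ are Cantor normal forms. Super-Jacobsthal exponentiation $\alpha^{\otimes\beta}$ is defined by transfinite recursion on $\beta$: $\alpha^{\otimes 0}=1$; $\alpha^{\otimes(\beta+1)}=(\alpha^{\otimes\beta})\otimes\alpha$; and for limit $\beta$, $\alpha^{\otimes\beta}=\sup_{\gamma<\beta}\alpha^{\otimes\gamma}$. *)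

theory Defs
  imports "HOL-Library.Infinite_Typeclass" "HOL-Library.Poly_Mapping"
begin

unbundle cardinal_syntax

section \<open>Ordinals as order types\<close>

text \<open>
  HOL has no type of all ordinals. An element of \<open>'a ordinal\<close> is the order type of a
  well-ordering of some subset of \<open>'a\<close>, so \<open>'a ordinal\<close> consists of all ordinals of cardinality
  at most \<open>|'a|\<close>. For infinite \<open>'a\<close> these are the ordinals below the regular
  cardinal \<open>|'a|\<^sup>+\<close>: every family indexed by \<open>'a\<close>, and every family indexed by an initial segment,
  is bounded (lemmas \<open>bdd_above_range_ordinal\<close> and \<open>bdd_above_image_lessThan_ordinal\<close> below), so
  that successors and the suprema occurring in transfinite recursions are the true ones. Every
  well-ordering in HOL is represented in \<open>'a ordinal\<close> for a suitable infinite type \<open>'a\<close>, and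
  finitely many well-orderings are represented in a common one.
\<close>

quotient_type 'a ordinal = "'a rel" / partial: "\<lambda>r s. r =o s"
proof (rule part_equivpI)
  show "\<exists>r :: 'a rel. r =o r"
    using card_of_refl by blast
  show "symp (\<lambda>r s :: 'a rel. r =o s)"
    by (rule sympI) (rule ordIso_symmetric)
  show "transp (\<lambda>r s :: 'a rel. r =o s)"
    by (rule transpI) (rule ordIso_transitive)
qed

lemma rep_ordinal_ordIso: "rep_ordinal x =o rep_ordinal x"
  using Quotient3_ordinal by (rule Quotient3_rep_reflp)

lemma Well_order_rep_ordinal: "Well_order (rep_ordinal x)"
  using rep_ordinal_ordIso[of x] unfolding ordIso_def by auto

lemma abs_ordinal_eq_iff:
  assumes "Well_order r" "Well_order s"
  shows "abs_ordinal r = abs_ordinal s \<longleftrightarrow> r =o s"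
  using Quotient3_rel[OF Quotient3_ordinal, of r s] ordIso_reflexive[OF assms(1)]
    ordIso_reflexive[OF assms(2)] by auto

lemma abs_rep_ordinal: "abs_ordinal (rep_ordinal x) = x"
  using Quotient3_ordinal by (rule Quotient3_abs_rep)

lemma rep_abs_ordinal: "Well_order r \<Longrightarrow> rep_ordinal (abs_ordinal r) =o r"
  by (metis abs_ordinal_eq_iff abs_rep_ordinal Well_order_rep_ordinal)

lemma ordinal_cases:
  obtains r where "Well_order r" "x = abs_ordinal r"
  using abs_rep_ordinal Well_order_rep_ordinal by metis

instantiation ordinal :: (type) linorder
begin

lift_definition less_eq_ordinal :: "'a ordinal \<Rightarrow> 'a ordinal \<Rightarrow> bool" is "\<lambda>r s. r \<le>o s"
  by (meson ordIso_ordLeq_trans ordIso_symmetric ordLeq_ordIso_trans)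

lift_definition less_ordinal :: "'a ordinal \<Rightarrow> 'a ordinal \<Rightarrow> bool" is "\<lambda>r s. r <o s"
  by (meson ordIso_ordLess_trans ordIso_symmetric ordLess_ordIso_trans)

lemma less_eq_ordinal_rep: "x \<le> y \<longleftrightarrow> rep_ordinal x \<le>o rep_ordinal y"
  by (simp add: less_eq_ordinal_def)

lemma less_ordinal_rep: "x < y \<longleftrightarrow> rep_ordinal x <o rep_ordinal y"
  by (simp add: less_ordinal_def)

instance
proof
  fix x y z :: "'a ordinal"
  show "x < y \<longleftrightarrow> x \<le> y \<and> \<not> y \<le> x"
    unfolding less_eq_ordinal_rep less_ordinal_rep
    by (meson Well_order_rep_ordinal not_ordLess_ordLeq not_ordLeq_iff_ordLess ordLess_imp_ordLeq)
  show "x \<le> x"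
    unfolding less_eq_ordinal_rep by (rule ordLeq_reflexive[OF Well_order_rep_ordinal])
  show "x \<le> y \<Longrightarrow> y \<le> z \<Longrightarrow> x \<le> z"
    unfolding less_eq_ordinal_rep by (rule ordLeq_transitive)
  show "x \<le> y \<Longrightarrow> y \<le> x \<Longrightarrow> x = y"
    unfolding less_eq_ordinal_rep
    by (metis abs_ordinal_eq_iff abs_rep_ordinal Well_order_rep_ordinal ordIso_iff_ordLeq)
  show "x \<le> y \<or> y \<le> x"
    unfolding less_eq_ordinal_rep
    by (rule ordLeq_total[OF Well_order_rep_ordinal Well_order_rep_ordinal])
qed

end

lemma less_ordinal_abs:
  "Well_order r \<Longrightarrow> Well_order s \<Longrightarrow> abs_ordinal r < abs_ordinal s \<longleftrightarrow> r <o s"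
  unfolding less_ordinal_rep
  by (meson rep_abs_ordinal ordIso_ordLess_trans ordIso_symmetric ordLess_ordIso_trans)

lemma less_eq_ordinal_abs:
  "Well_order r \<Longrightarrow> Well_order s \<Longrightarrow> abs_ordinal r \<le> abs_ordinal s \<longleftrightarrow> r \<le>o s"
  unfolding less_eq_ordinal_rep
  by (meson rep_abs_ordinal ordIso_ordLeq_trans ordIso_symmetric ordLeq_ordIso_trans)

instance ordinal :: (type) wellorder
proof
  fix P :: "'a ordinal \<Rightarrow> bool" and x
  assume step: "\<And>x. (\<And>y. y < x \<Longrightarrow> P y) \<Longrightarrow> P x"
  have "wf (inv_image ordLess (rep_ordinal :: 'a ordinal \<Rightarrow> 'a rel))"
    by (rule wf_inv_image[OF wf_ordLess])
  then show "P x"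
  proof (induction x rule: wf_induct_rule)
    case (less x)
    show ?case
      by (rule step, rule less) (simp add: less_ordinal_rep)
  qed
qed

instantiation ordinal :: (type) "{conditionally_complete_linorder, order_bot, zero}"
begin

definition zero_ordinal :: "'a ordinal" where "0 = abs_ordinal {}"
definition bot_ordinal :: "'a ordinal" where "bot = (0 :: 'a ordinal)"
definition inf_ordinal :: "'a ordinal \<Rightarrow> 'a ordinal \<Rightarrow> 'a ordinal" where "inf = (min :: 'a ordinal \<Rightarrow> _)"
definition sup_ordinal :: "'a ordinal \<Rightarrow> 'a ordinal \<Rightarrow> 'a ordinal" where "sup = (max :: 'a ordinal \<Rightarrow> _)"
definition Inf_ordinal :: "'a ordinal set \<Rightarrow> 'a ordinal" where "Inf A = (LEAST x :: 'a ordinal. x \<in> A)"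
definition Sup_ordinal :: "'a ordinal set \<Rightarrow> 'a ordinal"
  where "Sup A = (LEAST x :: 'a ordinal. \<forall>y\<in>A. y \<le> x)"

instance
proof
  fix x y z :: "'a ordinal" and A :: "'a ordinal set"
  show "inf x y \<le> x" "inf x y \<le> y" "x \<le> sup x y" "y \<le> sup x y"
    by (auto simp: inf_ordinal_def sup_ordinal_def)
  show "x \<le> y \<Longrightarrow> x \<le> z \<Longrightarrow> x \<le> inf y z" "y \<le> x \<Longrightarrow> z \<le> x \<Longrightarrow> sup y z \<le> x"
    by (auto simp: inf_ordinal_def sup_ordinal_def)
  show "x \<in> A \<Longrightarrow> bdd_below A \<Longrightarrow> Inf A \<le> x"
    by (simp add: Inf_ordinal_def Least_le)
  show "A \<noteq> {} \<Longrightarrow> (\<And>x. x \<in> A \<Longrightarrow> z \<le> x) \<Longrightarrow> z \<le> Inf A"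
    unfolding Inf_ordinal_def using LeastI_ex[of "\<lambda>x. x \<in> A"] by blast
  show "x \<in> A \<Longrightarrow> bdd_above A \<Longrightarrow> x \<le> Sup A"
    unfolding Sup_ordinal_def bdd_above_def
    using LeastI_ex[of "\<lambda>x. \<forall>y\<in>A. y \<le> x"] by blast
  show "A \<noteq> {} \<Longrightarrow> (\<And>x. x \<in> A \<Longrightarrow> x \<le> z) \<Longrightarrow> Sup A \<le> z"
    unfolding Sup_ordinal_def by (rule Least_le) auto
  obtain r where r: "Well_order r" "x = abs_ordinal r"
    by (rule ordinal_cases)
  have "Well_order ({} :: 'a rel)"
    by (simp add: well_order_on_def linear_order_on_def partial_order_on_def preorder_on_def
        refl_on_def trans_def antisym_def total_on_def)
  moreover have "({} :: 'a rel) \<le>o r"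
    using calculation r(1) by (auto simp: ordLeq_def embed_def)
  ultimately show "bot \<le> x"
    using r by (simp add: bot_ordinal_def zero_ordinal_def less_eq_ordinal_abs)
qed

end

lemma zero_le_ordinal [simp]: "0 \<le> (x :: 'a ordinal)"
  using bot_least[of x] by (simp add: bot_ordinal_def)

lemma not_less_zero_ordinal [simp]: "\<not> x < (0 :: 'a ordinal)"
  by (simp add: not_less)

lemma Sup_ordinal_empty: "Sup {} = (0 :: 'a ordinal)"
  unfolding Sup_ordinal_def by (rule Least_equality) auto

text \<open>The ordinals below the order type of \<open>r\<close> form an isomorphic copy of \<open>r\<close>.\<close>

lemma lessThan_ordinal_ordIso:
  fixes r :: "'a rel"
  assumes r: "Well_order r"
  shows "\<exists>f. bij_betw f (Field r) {..<abs_ordinal r} \<and>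
    (\<forall>a\<in>Field r. \<forall>b\<in>Field r. (a, b) \<in> r \<longrightarrow> f a \<le> f b)"
proof -
  define f where "f a = abs_ordinal (Restr r (underS r a))" for a
  have wo: "Well_order (Restr r (underS r a))" for a
    by (rule Well_order_Restr[OF r])
  interpret wo_rel r
    by (unfold_locales) (rule r)
  have less: "f a < f b" if "a \<in> Field r" "b \<in> Field r" "(a, b) \<in> r" "a \<noteq> b" for a b
  proof -
    have "underS a \<subseteq> underS b"
      unfolding underS_def using that ANTISYM TRANS by (blast dest: antisymD transD)
    moreover have "a \<in> underS b" "a \<notin> underS a"
      unfolding underS_def using that by blast+
    ultimately have "underS a \<subset> underS b"
      by blast
    then have "Restr r (underS a) <o Restr r (underS b)"
      by (simp only: ofilter_subset_ordLess[OF r underS_ofilter underS_ofilter])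
    then show ?thesis
      by (simp add: f_def less_ordinal_abs wo)
  qed
  have "f ` Field r = {..<abs_ordinal r}"
  proof (intro equalityI subsetI)
    fix x assume "x \<in> f ` Field r"
    then obtain a where a: "a \<in> Field r" "x = f a" by blast
    have "Restr r (underS a) <o r"
      using a underS_Restr_ordLess[OF r] by blast
    then show "x \<in> {..<abs_ordinal r}"
      using a by (simp add: f_def less_ordinal_abs wo r)
  next
    fix x assume "x \<in> {..<abs_ordinal r}"
    then have "x < abs_ordinal r" by simp
    obtain s where s: "Well_order s" "x = abs_ordinal s"
      by (rule ordinal_cases)
    with \<open>x < abs_ordinal r\<close> have "s <o r"
      by (simp add: less_ordinal_abs r)
    then obtain a where "a \<in> Field r" "s =o Restr r (underS a)"
      using ordLess_iff_ordIso_Restr[OF r s(1)] by blast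
    then show "x \<in> f ` Field r"
      using s wo by (metis abs_ordinal_eq_iff f_def image_eqI)
  qed
  moreover have "inj_on f (Field r)"
    by (rule inj_onI) (metis TOTALS less less_irrefl)
  moreover have "\<forall>a\<in>Field r. \<forall>b\<in>Field r. (a, b) \<in> r \<longrightarrow> f a \<le> f b"
    using less by (metis less_imp_le order_refl)
  ultimately show ?thesis
    unfolding bij_betw_def by blast
qed

lemma card_of_lessThan_ordinal: "|{..<x :: 'a ordinal}| \<le>o |UNIV :: 'a set|"
proof -
  obtain r :: "'a rel" where r: "Well_order r" "x = abs_ordinal r"
    by (rule ordinal_cases)
  then have "|{..<x}| =o |Field r|"
    using lessThan_ordinal_ordIso[OF r(1)] by (metis card_of_ordIsoI ordIso_symmetric)
  also have "|Field r| \<le>o |UNIV :: 'a set|"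
    by (rule card_of_mono1) simp
  finally show ?thesis .
qed

lemma card_of_ordinal_not_le: "\<not> |UNIV :: 'a ordinal set| \<le>o |UNIV :: 'a set|"
proof
  assume "|UNIV :: 'a ordinal set| \<le>o |UNIV :: 'a set|"
  then obtain g :: "'a ordinal \<Rightarrow> 'a" where g: "inj g"
    using card_of_ordLeq[of "UNIV :: 'a ordinal set" "UNIV :: 'a set"] by blast
  define s :: "'a ordinal rel" where "s = {(x, y). x \<le> y}"
  define r where "r = dir_image s g"
  have Field_s: "Field s = UNIV"
    by (auto simp: s_def Field_def)
  have "s - Id = {(x, y). x < y}"
    by (auto simp: s_def)
  then have "wf (s - Id)"
    using wf by simp
  moreover have "refl s" "trans s" "antisym s" "total s"
    by (auto simp: s_def intro!: refl_onI transI antisymI total_onI)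
  ultimately have s: "Well_order s"
    by (simp add: Field_s well_order_on_def linear_order_on_def partial_order_on_def
        preorder_on_def)
  have r: "Well_order r"
    unfolding r_def using s g by (intro Well_order_dir_image) (simp_all add: Field_s)
  obtain f where f: "bij_betw f (Field r) {..<abs_ordinal r}"
    and mono: "\<And>a b. a \<in> Field r \<Longrightarrow> b \<in> Field r \<Longrightarrow> (a, b) \<in> r \<Longrightarrow> f a \<le> f b"
    using lessThan_ordinal_ordIso[OF r] by blast
  have Field_r: "g x \<in> Field r" for x
    by (simp add: r_def dir_image_Field Field_s)
  define h where "h x = f (g x)" for x
  have h_le: "h x \<le> h y" if "x \<le> y" for x y
    unfolding h_def using that by (intro mono Field_r) (auto simp: r_def dir_image_def s_def)
  have h_inj: "h x = h y \<Longrightarrow> x = y" for x y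
    using inj_onD[OF bij_betw_imp_inj_on[OF f] _ Field_r Field_r] injD[OF g] by (simp add: h_def)
  have "x \<le> h x" for x
  proof (induction x rule: less_induct)
    case (less x)
    show ?case
    proof (rule ccontr)
      assume "\<not> x \<le> h x"
      then have "h x < x" by simp
      then have "h x \<le> h (h x)" "h (h x) \<le> h x"
        using less h_le[of "h x" x] by simp_all
      then show False
        using h_inj[of "h x" x] \<open>h x < x\<close> by (simp add: antisym)
    qed
  qed
  moreover have "h x < abs_ordinal r" for x
    using bij_betwE[OF f] Field_r by (simp add: h_def)
  ultimately show False
    using leD by blast
qed

lemma bdd_above_ordinal:
  fixes A :: "'a::infinite ordinal set"
  assumes A: "|A| \<le>o |UNIV :: 'a set|"
  shows "bdd_above A"
proof (rule ccontr)
  assume "\<not> bdd_above A"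
  then have "(UNIV :: 'a ordinal set) = (\<Union>x\<in>A. {..<x})"
    unfolding bdd_above_def by (auto simp: not_le)
  moreover have "|\<Union>x\<in>A. {..<x}| \<le>o |UNIV :: 'a set|"
    by (intro card_of_UNION_ordLeq_infinite[OF infinite_UNIV A] ballI card_of_lessThan_ordinal)
  ultimately show False
    using card_of_ordinal_not_le by metis
qed

lemma bdd_above_range_ordinal: "bdd_above (range (f :: 'a \<Rightarrow> 'a::infinite ordinal))"
  by (rule bdd_above_ordinal) (rule card_of_image)

lemma bdd_above_image_lessThan_ordinal:
  "bdd_above (f ` {..<x :: 'a::infinite ordinal} :: 'a ordinal set)"
  by (rule bdd_above_ordinal) (rule ordLeq_transitive[OF card_of_image card_of_lessThan_ordinal])

lemma ex_greater_ordinal: "\<exists>y. x < (y :: 'a::infinite ordinal)"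
proof -
  have "|{..<x} \<union> {x}| \<le>o |UNIV :: 'a set|"
    by (rule card_of_Un_ordLeq_infinite_Field[OF _ card_of_lessThan_ordinal
          card_of_singl_ordLeq card_of_Card_order])
      (simp_all add: Field_card_of infinite_UNIV)
  then have "{..<x} \<union> {x} \<noteq> UNIV"
    using card_of_ordinal_not_le by metis
  then show ?thesis
    by (metis UNIV_eq_I UnCI insertI1 lessThan_iff linorder_neqE)
qed

unbundle no cardinal_syntax


section \<open>Ordinal arithmetic\<close>

definition osucc :: "'a ordinal \<Rightarrow> 'a ordinal"
  where "osucc x = (LEAST y. x < y)"

lemma less_osucc: "x < osucc (x :: 'a::infinite ordinal)"
  unfolding osucc_def using ex_greater_ordinal by (rule LeastI_ex)

lemma osucc_le_iff: "osucc x \<le> y \<longleftrightarrow> x < (y :: 'a::infinite ordinal)"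
  using less_osucc[of x] by (auto simp: osucc_def intro: Least_le)

lemma osucc_inject [simp]: "osucc x = osucc y \<longleftrightarrow> x = (y :: 'a::infinite ordinal)"
  using less_osucc osucc_le_iff by (metis leD linorder_neqE)

lemma osucc_neq_zero [simp]: "osucc x \<noteq> (0 :: 'a::infinite ordinal)"
  using less_osucc[of x] by (metis not_less_zero_ordinal)

definition limit_ordinal :: "'a ordinal \<Rightarrow> bool"
  where "limit_ordinal x \<longleftrightarrow> x \<noteq> 0 \<and> (\<nexists>y. x = osucc y)"

text \<open>Transfinite recursion, with suprema at limits.\<close>

function ordinal_rec :: "'b ordinal \<Rightarrow> ('b ordinal \<Rightarrow> 'b ordinal) \<Rightarrow> 'a::infinite ordinal \<Rightarrow> 'b ordinal"
  where "ordinal_rec z s b =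
    (if b = 0 then z
     else if \<exists>c. b = osucc c then s (ordinal_rec z s (THE c. b = osucc c))
     else (SUP c\<in>{..<b}. ordinal_rec z s c))"
  by pat_completeness auto
termination
  by (relation "inv_image {(x, y). x < y} (\<lambda>(z, s, b). b)") (auto intro: wf less_osucc)

declare ordinal_rec.simps [simp del]

lemma ordinal_rec_0: "ordinal_rec z s 0 = z"
  by (subst ordinal_rec.simps) simp

lemma ordinal_rec_osucc: "ordinal_rec z s (osucc b) = s (ordinal_rec z s b)"
  by (subst ordinal_rec.simps) simp

lemma ordinal_rec_limit: "limit_ordinal b \<Longrightarrow> ordinal_rec z s b = (SUP c\<in>{..<b}. ordinal_rec z s c)"
  by (subst ordinal_rec.simps) (auto simp: limit_ordinal_def)

instantiation ordinal :: (infinite) "{one, plus, times}"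
begin

definition one_ordinal :: "'a ordinal" where "1 = osucc (0 :: 'a ordinal)"

definition plus_ordinal :: "'a ordinal \<Rightarrow> 'a ordinal \<Rightarrow> 'a ordinal"
  where "x + y = ordinal_rec x osucc (y :: 'a ordinal)"

definition times_ordinal :: "'a ordinal \<Rightarrow> 'a ordinal \<Rightarrow> 'a ordinal"
  where "x * y = ordinal_rec 0 (\<lambda>u. u + x) (y :: 'a ordinal)"

instance ..

end

definition opow :: "'a::infinite ordinal \<Rightarrow> 'a ordinal \<Rightarrow> 'a ordinal"
  where "opow x y = ordinal_rec 1 (\<lambda>u. u * x) y"

definition ordinal_of_nat :: "nat \<Rightarrow> 'a::infinite ordinal"
  where "ordinal_of_nat n = (osucc ^^ n) 0"

definition omega :: "'a::infinite ordinal"  (\<open>\<omega>\<close>)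
  where "\<omega> = (SUP n. ordinal_of_nat n)"


section \<open>Cantor normal form and the natural operations\<close>

text \<open>
  A Cantor normal form is given by its finitely supported family of coefficients: the
  exponents are the keys, and their coefficients are positive.
\<close>

type_synonym 'a cnf = "'a ordinal \<Rightarrow>\<^sub>0 nat"

definition exponents :: "'a cnf \<Rightarrow> 'a ordinal list"  \<comment> \<open>in decreasing order\<close>
  where "exponents p = rev (sorted_list_of_set (Poly_Mapping.keys p))"

definition cnf_value :: "'a::infinite cnf \<Rightarrow> 'a ordinal"
  where "cnf_value p =
    foldr (\<lambda>c u. opow \<omega> c * ordinal_of_nat (Poly_Mapping.lookup p c) + u) (exponents p) 0"

text \<open>By Cantor's normal form theorem, every ordinal is the value of exactly one \<open>p\<close>.\<close>

definition cnf :: "'a::infinite ordinal \<Rightarrow> 'a cnf"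
  where "cnf x = (THE p. cnf_value p = x)"

definition natural_sum :: "'a::infinite ordinal \<Rightarrow> 'a ordinal \<Rightarrow> 'a ordinal"
    (infixl \<open>\<oplus>\<close> 65)
  where "x \<oplus> y = cnf_value (cnf x + cnf y)"

definition natural_prod :: "'a::infinite ordinal \<Rightarrow> 'a ordinal \<Rightarrow> 'a ordinal"
    (infixl \<open>\<otimes>\<close> 70)
  where "x \<otimes> y =
    foldr (\<oplus>)
      [opow \<omega> (c \<oplus> d)
          * ordinal_of_nat (Poly_Mapping.lookup (cnf x) c * Poly_Mapping.lookup (cnf y) d).
        c \<leftarrow> exponents (cnf x), d \<leftarrow> exponents (cnf y)]
      0"

definition super_jacobsthal :: "'a::infinite ordinal \<Rightarrow> 'a ordinal \<Rightarrow> 'a ordinal"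
    (infixr \<open>^\<otimes>\<close> 80)
  where "x ^\<otimes> y = ordinal_rec 1 (\<lambda>u. u \<otimes> x) y"

lemma super_jacobsthal_0: "x ^\<otimes> 0 = 1"
  by (simp add: super_jacobsthal_def ordinal_rec_0)

lemma super_jacobsthal_osucc: "x ^\<otimes> osucc y = (x ^\<otimes> y) \<otimes> x"
  by (simp add: super_jacobsthal_def ordinal_rec_osucc)

lemma super_jacobsthal_limit: "limit_ordinal y \<Longrightarrow> x ^\<otimes> y = (SUP z\<in>{..<y}. x ^\<otimes> z)"
  by (simp add: super_jacobsthal_def ordinal_rec_limit)

end

theory Submission
  imports Defs
begin

text \<open>
  Write exponents as \<open>\<omega> * z + n\<close> with \<open>n\<close> finite. Natural sums of such exponents are formed
  componentwise, and \<open>x ^\<otimes> (\<omega> * z + n) = g z \<otimes> x ^\<otimes> n\<close> for \<open>g z = x ^\<otimes> (\<omega> * z)\<close>, so the law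
  reduces to \<open>g (y \<oplus> z) = g y \<otimes> g z\<close>. Here \<open>g\<close> is explicit. It is constantly \<open>1\<close> for \<open>x \<le> 1\<close>.
  Otherwise \<open>g z = \<omega>\<^bsup>u * z\<^esup>\<close> with \<open>u = \<omega>\<^bsup>e\<^esup>\<close>, where \<open>e = 0\<close> for finite \<open>x\<close>, and \<open>e = b + 1\<close> for infinite \<open>x\<close>
  with leading exponent \<open>a\<close> and \<open>b\<close> the leading exponent of \<open>a\<close>: the exponents in the
  Cantor normal forms of the finite powers of \<open>x\<close> stay below \<open>u\<close> and are cofinal in it. Multiplication by
  \<open>u\<close> from the left shifts the exponents of a Cantor normal form by \<open>e\<close>, hence is additive
  for \<open>\<oplus>\<close>.
\<close>

section \<open>Normal functions\<close>

lemma less_osucc_iff: "x < osucc y \<longleftrightarrow> x \<le> (y :: 'a::infinite ordinal)"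
  using osucc_le_iff[of y x] by (meson not_less)

lemma zero_less_osucc [simp]: "0 < osucc (x :: 'a::infinite ordinal)"
  by (simp add: less_osucc_iff)

lemma zero_less_iff_ordinal: "0 < x \<longleftrightarrow> x \<noteq> (0 :: 'a ordinal)"
  by (metis less_le zero_le_ordinal)

lemma ordinal_induct [case_names zero osucc limit]:
  fixes x :: "'a::infinite ordinal"
  assumes "P 0" "\<And>x. P x \<Longrightarrow> P (osucc x)"
    and "\<And>x. limit_ordinal x \<Longrightarrow> (\<And>y. y < x \<Longrightarrow> P y) \<Longrightarrow> P x"
  shows "P x"
proof (induction x rule: less_induct)
  case (less x)
  show ?case
    using assms less less_osucc unfolding limit_ordinal_def by metis
qed

lemma osucc_less_limit:
  "limit_ordinal x \<Longrightarrow> y < x \<Longrightarrow> osucc y < (x :: 'a::infinite ordinal)"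
  by (metis osucc_le_iff limit_ordinal_def order_le_less)

lemma limit_ordinalI:
  fixes x :: "'a::infinite ordinal"
  assumes "x \<noteq> 0" "\<And>y. y < x \<Longrightarrow> osucc y < x"
  shows "limit_ordinal x"
  using assms less_osucc less_irrefl unfolding limit_ordinal_def by metis

text \<open>Continuity at limits is put as cofinality: every \<open>w\<close> below
  \<open>f x\<close> is passed by some \<open>f y\<close> with \<open>y < x\<close>. With
  monotonicity this makes \<open>f x\<close> the supremum of the earlier values, without
  \<open>SUP\<close> and its boundedness condition.\<close>

definition normal :: "('a::infinite ordinal \<Rightarrow> 'a ordinal) \<Rightarrow> bool"
  where "normal f \<longleftrightarrow> strict_mono f \<and> (\<forall>x. limit_ordinal x \<longrightarrow> (\<forall>w<f x. \<exists>y<x. w < f y))"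

lemma normal_less_iff: "normal f \<Longrightarrow> f x < f y \<longleftrightarrow> x < y"
  by (simp add: normal_def strict_mono_less)

lemma normal_le_iff: "normal f \<Longrightarrow> f x \<le> f y \<longleftrightarrow> x \<le> y"
  by (simp add: normal_def strict_mono_less_eq)

lemma normal_eq_iff: "normal f \<Longrightarrow> f x = f y \<longleftrightarrow> x = y"
  by (simp add: normal_def strict_mono_eq)

lemma normal_less_limit: "normal f \<Longrightarrow> limit_ordinal x \<Longrightarrow> w < f x \<Longrightarrow> \<exists>y<x. w < f y"
  by (simp add: normal_def)

text \<open>If \<open>f x < x\<close>, the induction hypothesis at \<open>f x\<close> contradicts
  \<open>f (f x) < f x\<close>.\<close>

lemma normal_ge:
  fixes f :: "'a::infinite ordinal \<Rightarrow> 'a ordinal"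
  assumes "normal f"
  shows "x \<le> f x"
proof (induction x rule: less_induct)
  case (less x)
  then show ?case
    using normal_less_iff[OF assms] by (meson leD not_less)
qed

lemma normal_limit:
  assumes "normal f" "limit_ordinal x"
  shows "limit_ordinal (f x)"
proof (rule limit_ordinalI)
  show "f x \<noteq> 0"
    using assms by (metis limit_ordinal_def normal_less_iff not_less_zero_ordinal zero_less_iff_ordinal)
  show "osucc y < f x" if "y < f x" for y
    using normal_less_limit[OF assms that] normal_less_iff[OF assms(1)]
    by (metis order_le_less_trans osucc_le_iff)
qed

lemma normal_comp:
  assumes f: "normal f" and g: "normal g"
  shows "normal (\<lambda>x. f (g x))"
  unfolding normal_def
proof (intro conjI allI impI)
  show "strict_mono (\<lambda>x. f (g x))"
    by (simp add: strict_mono_def normal_less_iff f g)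
  fix x w assume x: "limit_ordinal x" and "w < f (g x)"
  then obtain y where "y < g x" "w < f y"
    using normal_less_limit[OF f normal_limit[OF g x]] by blast
  moreover from this obtain z where "z < x" "y < g z"
    using normal_less_limit[OF g x] by blast
  ultimately show "\<exists>z<x. w < f (g z)"
    using normal_less_iff[OF f] by (meson less_trans)
qed

text \<open>Replaces separate transfinite inductions: associativity, distributivity and the exponent
  law hold because both sides are normal in the last argument and obey the same recursion. At a
  limit neither value is smaller, since the larger one would be approached by earlier values, which
  are common to both.\<close>

lemma normal_unique:
  assumes f: "normal f" and g: "normal g"
    and "f 0 = g 0" "\<And>x. f (osucc x) = s (f x)" "\<And>x. g (osucc x) = s (g x)"
  shows "f x = g x"
proof (induction x rule: ordinal_induct)
  case (limit x)
  have "\<not> f x < g x"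
    using normal_less_limit[OF g limit(1)] normal_less_iff[OF f] limit(2) less_asym by metis
  moreover have "\<not> g x < f x"
    using normal_less_limit[OF f limit(1)] normal_less_iff[OF g] limit(2) less_asym by metis
  ultimately show ?case
    by (meson linorder_neqE)
qed (use assms in simp_all)

text \<open>The least \<open>y\<close> with \<open>z < f y\<close> is neither 0 nor, by continuity,
  a limit, so its predecessor is the sought \<open>x\<close>. Addition, multiplication and powers of
  \<omega> as \<open>f\<close> give subtraction, division with remainder and the leading
  exponent.\<close>

lemma normal_bracket:
  fixes f :: "'a::infinite ordinal \<Rightarrow> 'a ordinal"
  assumes f: "normal f" and "f 0 \<le> z"
  shows "\<exists>x. f x \<le> z \<and> z < f (osucc x)"
proof -
  define y where "y = (LEAST y. z < f y)"
  have "z < f (osucc z)"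
    using normal_ge[OF f, of "osucc z"] less_osucc by (meson less_le_trans)
  then have y: "z < f y" and least: "\<And>x. z < f x \<Longrightarrow> y \<le> x"
    unfolding y_def by (rule LeastI, auto intro: Least_le)
  have "y \<noteq> 0"
    using y assms(2) by auto
  moreover have "\<not> limit_ordinal y"
    using normal_less_limit[OF f _ y] least leD by blast
  ultimately obtain x where "y = osucc x"
    by (auto simp: limit_ordinal_def)
  then show ?thesis
    using y least less_osucc by (metis leD not_le_imp_less)
qed

text \<open>The step is required to increase only from \<open>z\<close> on, since the step
  \<open>\<lambda>u. u * \<omega>\<close> of \<open>opow \<omega>\<close> fixes 0. The induction
  therefore also carries \<open>z \<le> ?f x\<close>.\<close>

lemma normal_ordinal_rec:
  fixes z :: "'a::infinite ordinal"
  assumes s: "\<And>u. z \<le> u \<Longrightarrow> u < s u"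
  shows "normal (ordinal_rec z s :: 'a ordinal \<Rightarrow> 'a ordinal)" (is "normal ?f")
proof -
  have upper: "?f y \<le> (SUP y\<in>{..<x}. ?f y)" if "y < x" for x y
    by (rule cSUP_upper) (simp_all add: that bdd_above_image_lessThan_ordinal)
  have "z \<le> ?f x \<and> (\<forall>y<x. ?f y < ?f x)" for x
  proof (induction x rule: ordinal_induct)
    case zero
    then show ?case
      by (simp add: ordinal_rec_0)
  next
    case (osucc x)
    then show ?case
      using s[of "?f x"] unfolding ordinal_rec_osucc less_osucc_iff
      by (metis dual_order.strict_trans order_le_less order_le_less_trans)
  next
    case (limit x)
    have "?f y < ?f x" if "y < x" for y
    proof -
      \<comment> \<open>The supremum alone gives only \<le>; strictness comes from the detour over
        \<open>osucc y\<close>, which is still below \<open>x\<close>.\<close>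
      have "?f y < ?f (osucc y)"
        using limit osucc_less_limit[OF limit(1) that] less_osucc by blast
      also have "\<dots> \<le> ?f x"
        using upper osucc_less_limit[OF limit(1) that] limit(1) by (simp add: ordinal_rec_limit)
      finally show ?thesis .
    qed
    moreover have "0 < x"
      using limit(1) by (simp add: limit_ordinal_def zero_less_iff_ordinal)
    ultimately show ?case
      by (metis order_less_imp_le ordinal_rec_0)
  qed
  moreover have "\<exists>y<x. w < ?f y" if x: "limit_ordinal x" and w: "w < ?f x" for x w
  proof -
    have "0 \<in> {..<x}"
      using x by (simp add: limit_ordinal_def zero_less_iff_ordinal)
    then have "{..<x} \<noteq> {}"
      by blast
    then show ?thesis
      using w less_cSUP_iff[OF _ bdd_above_image_lessThan_ordinal[of ?f x], of w]
      unfolding ordinal_rec_limit[OF x] by auto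
  qed
  ultimately show ?thesis
    unfolding normal_def strict_mono_def by blast
qed


section \<open>Ordinal arithmetic\<close>

lemma add_zero_ordinal [simp]: "x + 0 = (x :: 'a::infinite ordinal)"
  by (simp add: plus_ordinal_def ordinal_rec_0)

lemma add_osucc [simp]: "x + osucc y = osucc (x + y :: 'a::infinite ordinal)"
  by (simp add: plus_ordinal_def ordinal_rec_osucc)

lemma normal_add: "normal ((+) (x :: 'a::infinite ordinal))"
  unfolding plus_ordinal_def by (rule normal_ordinal_rec) (rule less_osucc)

lemma normal_id: "normal (\<lambda>x. x)"
  unfolding normal_def strict_mono_def using less_osucc osucc_less_limit by blast

text \<open>The instance also provides the convolution product on \<open>'a cnf\<close>, in which
  multiplication by a power of \<omega> from the left is computed later.\<close>

instance ordinal :: (infinite) monoid_add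
proof
  fix x y z :: "'a ordinal"
  show "x + y + z = x + (y + z)"
    by (rule normal_unique[OF normal_add normal_comp[OF normal_add normal_add]]) simp_all
  show "0 + x = x"
    by (rule normal_unique[OF normal_add normal_id]) simp_all
qed simp

lemma add_less_cancel_left_ordinal [simp]: "x + y < x + z \<longleftrightarrow> y < (z :: 'a::infinite ordinal)"
  by (rule normal_less_iff[OF normal_add])

lemma add_le_cancel_left_ordinal [simp]: "x + y \<le> x + z \<longleftrightarrow> y \<le> (z :: 'a::infinite ordinal)"
  by (rule normal_le_iff[OF normal_add])

lemma add_cancel_left_ordinal [simp]: "x + y = x + z \<longleftrightarrow> y = (z :: 'a::infinite ordinal)"
  by (rule normal_eq_iff[OF normal_add])

lemma le_add_left_ordinal [simp]: "y \<le> x + (y :: 'a::infinite ordinal)"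
  by (rule normal_ge[OF normal_add])

lemma le_add_right_ordinal [simp]: "x \<le> x + (y :: 'a::infinite ordinal)"
  using add_le_cancel_left_ordinal[of x 0 y] by simp

lemma le_imp_add_ordinal:
  assumes "x \<le> (y :: 'a::infinite ordinal)"
  obtains z where "y = x + z"
proof -
  obtain z where "x + z \<le> y" "y < x + osucc z"
    using normal_bracket[OF normal_add, of x y] assms by auto
  then have "y = x + z"
    by (simp add: less_osucc_iff)
  then show ?thesis
    by (rule that)
qed

section \<open>Multiplication and division with remainder\<close>

lemma times_zero_ordinal [simp]: "x * 0 = (0 :: 'a::infinite ordinal)"
  by (simp add: times_ordinal_def ordinal_rec_0)

lemma times_osucc [simp]: "x * osucc y = x * y + (x :: 'a::infinite ordinal)"
  by (simp add: times_ordinal_def ordinal_rec_osucc)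

lemma normal_times:
  assumes "0 < (x :: 'a::infinite ordinal)"
  shows "normal ((*) x)"
  unfolding times_ordinal_def
  by (rule normal_ordinal_rec) (metis add_less_cancel_left_ordinal add_zero_ordinal assms)

lemma times_add_ordinal:
  assumes "0 < (x :: 'a::infinite ordinal)"
  shows "x * (y + z) = x * y + x * z"
  by (rule normal_unique[OF normal_comp[OF normal_times[OF assms] normal_add]
        normal_comp[OF normal_add normal_times[OF assms]], where s = "\<lambda>u. u + x"])
    (simp_all add: add.assoc)

lemma times_pos_ordinal: "0 < x \<Longrightarrow> 0 < y \<Longrightarrow> 0 < x * (y :: 'a::infinite ordinal)"
  using normal_less_iff[OF normal_times, of x 0 y] by simp

lemma times_assoc_ordinal:
  assumes "0 < x" "0 < (y :: 'a::infinite ordinal)"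
  shows "x * y * z = x * (y * z)"
  by (rule normal_unique[OF normal_times[OF times_pos_ordinal[OF assms]]
        normal_comp[OF normal_times[OF assms(1)] normal_times[OF assms(2)]],
        where s = "\<lambda>u. u + x * y"])
    (simp_all add: assms times_add_ordinal)

lemma zero_less_one_ordinal [simp]: "0 < (1 :: 'a::infinite ordinal)"
  by (simp add: one_ordinal_def)

lemma times_one_ordinal [simp]: "x * 1 = (x :: 'a::infinite ordinal)"
  by (simp add: one_ordinal_def)

lemma one_times_ordinal [simp]: "1 * x = (x :: 'a::infinite ordinal)"
  by (rule normal_unique[OF normal_times[OF zero_less_one_ordinal] normal_id])
    (simp_all add: one_ordinal_def)

lemma ordinal_division:
  assumes "0 < (u :: 'a::infinite ordinal)"
  obtains q r where "x = u * q + r" "r < u"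
proof -
  obtain q where "u * q \<le> x" "x < u * osucc q"
    using normal_bracket[OF normal_times[OF assms], of x] by auto
  moreover from this obtain r where "x = u * q + r"
    by (elim le_imp_add_ordinal)
  ultimately show ?thesis
    using that by simp
qed

section \<open>Finite ordinals and \<omega>\<close>

lemma ordinal_of_nat_0 [simp]: "ordinal_of_nat 0 = 0"
  by (simp add: ordinal_of_nat_def)

lemma ordinal_of_nat_Suc [simp]: "ordinal_of_nat (Suc n) = osucc (ordinal_of_nat n)"
  by (simp add: ordinal_of_nat_def)

lemma ordinal_of_nat_add: "ordinal_of_nat (m + n) = ordinal_of_nat m + ordinal_of_nat n"
  by (induction n) simp_all

lemma ordinal_of_nat_mono: "m < n \<Longrightarrow> ordinal_of_nat m < ordinal_of_nat n"
  by (rule lift_Suc_mono_less) (simp_all add: less_osucc)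

lemma ordinal_of_nat_less_iff [simp]: "ordinal_of_nat m < ordinal_of_nat n \<longleftrightarrow> m < n"
  by (metis ordinal_of_nat_mono less_asym less_irrefl linorder_neqE_nat)


lemma ordinal_of_nat_le_iff [simp]: "ordinal_of_nat m \<le> ordinal_of_nat n \<longleftrightarrow> m \<le> n"
  by (simp flip: not_less)

lemma less_omega_iff: "x < \<omega> \<longleftrightarrow> (\<exists>n. x = ordinal_of_nat n)"
proof
  have bdd: "bdd_above (range (ordinal_of_nat :: nat \<Rightarrow> 'a::infinite ordinal))"
  proof -
    \<comment> \<open>Boundedness is known for families indexed by \<open>'a\<close>; an injection
      of \<open>nat\<close> into this infinite type reindexes the finite ordinals by
      \<open>'a\<close>.\<close>
    obtain g :: "nat \<Rightarrow> 'a" where "inj g"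
      using infinite_countable_subset[OF infinite_UNIV[where 'a = 'a]] by metis
    then have "range ordinal_of_nat = range (\<lambda>a. ordinal_of_nat (inv g a) :: 'a ordinal)"
      by (auto simp: image_iff) (metis inv_f_f)
    then show ?thesis
      using bdd_above_range_ordinal by metis
  qed
  have less: "ordinal_of_nat n < (\<omega> :: 'a ordinal)" for n
    unfolding omega_def using bdd less_cSUP_iff[OF _ bdd] by (auto intro: exI[of _ "Suc n"])
  show "x < \<omega>" if "\<exists>n. x = ordinal_of_nat n" for x :: "'a ordinal"
    using that less by blast
  show "\<exists>n. x = ordinal_of_nat n" if x: "x < \<omega>" for x :: "'a ordinal"
  proof -
    obtain n where "x < ordinal_of_nat n"
      using x less_cSUP_iff[OF _ bdd] unfolding omega_def by auto
    then show ?thesis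
      by (induction n) (auto simp: less_osucc_iff order_le_less)
  qed
qed

lemma ordinal_of_nat_less_omega [simp]: "ordinal_of_nat n < \<omega>"
  by (auto simp: less_omega_iff)

lemma zero_less_omega [simp]: "0 < \<omega>"
  using ordinal_of_nat_less_omega[of 0] by simp

lemma one_less_omega: "1 < \<omega>"
  using ordinal_of_nat_less_omega[of 1] by (simp add: one_ordinal_def)

lemma limit_ordinal_omega: "limit_ordinal \<omega>"
proof (rule limit_ordinalI)
  show "\<omega> \<noteq> 0"
    using zero_less_omega zero_less_iff_ordinal by blast
  show "osucc y < \<omega>" if "y < \<omega>" for y
    using that ordinal_of_nat_less_omega by (metis less_omega_iff ordinal_of_nat_Suc)
qed

lemma times_nat_less_times_omega: "0 < x \<Longrightarrow> x * ordinal_of_nat n < x * \<omega>"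
  by (simp add: normal_less_iff[OF normal_times])

lemma less_times_omega: "0 < x \<Longrightarrow> w < x * \<omega> \<Longrightarrow> \<exists>n. w < x * ordinal_of_nat n"
  using normal_less_limit[OF normal_times limit_ordinal_omega, of x w] less_omega_iff by metis

lemma ordinal_of_nat_1: "ordinal_of_nat 1 = 1"
  by (simp add: one_ordinal_def)

section \<open>Powers of \<omega>\<close>

lemma opow_zero [simp]: "opow x 0 = 1"
  by (simp add: opow_def ordinal_rec_0)

lemma opow_osucc [simp]: "opow x (osucc y) = opow x y * x"
  by (simp add: opow_def ordinal_rec_osucc)

lemma opow_one [simp]: "opow x 1 = x"
  by (simp add: one_ordinal_def)
    (simp flip: one_ordinal_def)

lemma normal_opow_omega: "normal (opow \<omega>)"
  unfolding opow_def
proof (rule normal_ordinal_rec)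
  fix u :: "'a ordinal"
  assume "1 \<le> u"
  then have "0 < u"
    using zero_less_one_ordinal by (rule less_le_trans[rotated])
  then show "u < u * \<omega>"
    using normal_less_iff[OF normal_times, of u 1 \<omega>] one_less_omega by simp
qed

lemma opow_omega_less_iff [simp]: "opow \<omega> x < opow \<omega> y \<longleftrightarrow> x < y"
  by (rule normal_less_iff[OF normal_opow_omega])

lemma opow_omega_le_iff [simp]: "opow \<omega> x \<le> opow \<omega> y \<longleftrightarrow> x \<le> y"
  by (rule normal_le_iff[OF normal_opow_omega])

lemma one_le_opow_omega: "1 \<le> opow \<omega> x"
  using opow_omega_le_iff[of 0 x] by simp

lemma opow_omega_pos [simp]: "0 < opow \<omega> x"
  using one_le_opow_omega zero_less_one_ordinal by (rule less_le_trans[rotated])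

lemma opow_omega_add: "opow \<omega> (x + y) = opow \<omega> x * opow \<omega> y"
  by (rule normal_unique[OF normal_comp[OF normal_opow_omega normal_add]
        normal_comp[OF normal_times[OF opow_omega_pos] normal_opow_omega], where s = "\<lambda>u. u * \<omega>"])
    (simp_all add: times_assoc_ordinal)

text \<open>A limit exponent is approached through smaller powers, where \<open>n = 1\<close>
  suffices; a successor exponent \<open>osucc y\<close> through the finite multiples of
  \<open>opow \<omega> y\<close>.\<close>

lemma less_opow_omega:
  assumes "w < opow \<omega> x" "x \<noteq> 0"
  shows "\<exists>y<x. \<exists>n. w < opow \<omega> y * ordinal_of_nat n"
proof (cases "limit_ordinal x")
  case True
  then obtain y where "y < x" "w < opow \<omega> y"
    using normal_less_limit[OF normal_opow_omega _ assms(1)] by blast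
  moreover have "opow \<omega> y * ordinal_of_nat 1 = opow \<omega> y"
    unfolding ordinal_of_nat_1 by simp
  ultimately show ?thesis
    by metis
next
  case False
  then obtain y where "x = osucc y"
    using assms(2) by (auto simp: limit_ordinal_def)
  then show ?thesis
    using assms(1) less_times_omega[OF opow_omega_pos, of w y] less_osucc by auto
qed


section \<open>Cantor normal form\<close>

lemma keys_single_add:
  assumes "0 < (n :: nat)"
  shows "Poly_Mapping.keys (Poly_Mapping.single c n + p) = insert c (Poly_Mapping.keys p)"
  using assms by (auto simp: in_keys_iff lookup_add lookup_single when_def split: if_splits)

lemma poly_mapping_decompose:
  fixes p :: "'k \<Rightarrow>\<^sub>0 nat"
  obtains q where "p = Poly_Mapping.single c (Poly_Mapping.lookup p c) + q" "Poly_Mapping.lookup q c = 0"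
proof
  show "p = Poly_Mapping.single c (Poly_Mapping.lookup p c) + Poly_Mapping.update c 0 p"
    by (rule poly_mapping_eqI) (simp add: lookup_add lookup_single lookup_update when_def)
qed (simp add: lookup_update)

text \<open>A normal form is built by putting a new leading term in front, matching the
  \<open>foldr\<close> in \<open>cnf_value\<close>. The proof counts exponents and splits off the
  largest one.\<close>

lemma poly_mapping_max_induct [case_names zero add]:
  fixes p :: "'k::linorder \<Rightarrow>\<^sub>0 nat"
  assumes "P 0"
    and step: "\<And>p c n. P p \<Longrightarrow> \<forall>k\<in>Poly_Mapping.keys p. k < c \<Longrightarrow> 0 < n \<Longrightarrow> P (Poly_Mapping.single c n + p)"
  shows "P p"
proof (induction "card (Poly_Mapping.keys p)" arbitrary: p)
  case 0
  then show ?case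
    using assms(1) by simp
next
  case (Suc m)
  define c where "c = Max (Poly_Mapping.keys p)"
  obtain q where q: "p = Poly_Mapping.single c (Poly_Mapping.lookup p c) + q"
    and lookup_q: "Poly_Mapping.lookup q c = 0"
    by (rule poly_mapping_decompose)
  have ne: "Poly_Mapping.keys p \<noteq> {}"
    using Suc(2) by auto
  then have c: "c \<in> Poly_Mapping.keys p"
    unfolding c_def by simp
  have "0 < Poly_Mapping.lookup p c"
    using c by (simp add: in_keys_iff)
  then have "Poly_Mapping.keys p = insert c (Poly_Mapping.keys q)"
    by (subst q) (rule keys_single_add)
  moreover have "c \<notin> Poly_Mapping.keys q"
    using lookup_q by (simp add: in_keys_iff)
  ultimately have keys: "Poly_Mapping.keys q = Poly_Mapping.keys p - {c}"
    by blast
  have "P q"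
    by (rule Suc(1)) (use Suc(2) c in \<open>simp add: keys\<close>)
  moreover have "\<forall>k\<in>Poly_Mapping.keys q. k < c"
    unfolding keys c_def by (auto simp: less_le)
  ultimately show ?case
    using step q \<open>0 < Poly_Mapping.lookup p c\<close> by metis
qed

lemma exponents_single_add:
  assumes "\<forall>k\<in>Poly_Mapping.keys p. k < c" "0 < n"
  shows "exponents (Poly_Mapping.single c n + p) = c # exponents p"
proof -
  have "Poly_Mapping.keys (Poly_Mapping.single c n + p) = insert c (Poly_Mapping.keys p)"
    using assms(2) by (rule keys_single_add)
  moreover have "sorted_list_of_set (insert c (Poly_Mapping.keys p)) =
      sorted_list_of_set (Poly_Mapping.keys p) @ [c]"
  proof -
    let ?l = "sorted_list_of_set (Poly_Mapping.keys p) @ [c]"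
    have "sorted ?l" "distinct ?l"
      using assms by (auto simp: sorted_append)
    moreover have "set ?l = insert c (Poly_Mapping.keys p)"
      by simp
    ultimately show ?thesis
      by (metis sorted_list_of_set.idem_if_sorted_distinct)
  qed
  ultimately show ?thesis
    by (simp add: exponents_def)
qed

lemma set_exponents [simp]: "set (exponents p) = Poly_Mapping.keys p"
  by (simp add: exponents_def)

lemma distinct_exponents [simp]: "distinct (exponents p)"
  by (simp add: exponents_def)

lemma cnf_value_zero [simp]: "cnf_value 0 = 0"
  by (simp add: cnf_value_def exponents_def)

lemma cnf_value_single_add:
  assumes p: "\<forall>k\<in>Poly_Mapping.keys p. k < c"
  shows "cnf_value (Poly_Mapping.single c n + p) = opow \<omega> c * ordinal_of_nat n + cnf_value p"
proof (cases "n = 0")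
  case False
  then have "cnf_value (Poly_Mapping.single c n + p) =
      opow \<omega> c * ordinal_of_nat (n + Poly_Mapping.lookup p c) +
      foldr (\<lambda>d u. opow \<omega> d * ordinal_of_nat (Poly_Mapping.lookup (Poly_Mapping.single c n + p) d) + u)
        (exponents p) 0"
    by (simp add: cnf_value_def exponents_single_add[OF p] lookup_add)
  also have "Poly_Mapping.lookup p c = 0"
    using p by (auto simp flip: not_in_keys_iff_lookup_eq_zero)
  also have "foldr (\<lambda>d u. opow \<omega> d * ordinal_of_nat (Poly_Mapping.lookup (Poly_Mapping.single c n + p) d) + u)
      (exponents p) 0 = cnf_value p"
    unfolding cnf_value_def using p
    by (intro foldr_cong) (auto simp: lookup_add lookup_single when_def)
  finally show ?thesis
    by simp
qed simp

lemma cnf_value_single: "cnf_value (Poly_Mapping.single c n) = opow \<omega> c * ordinal_of_nat n"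
  using cnf_value_single_add[of 0 c n] by simp

lemma cnf_value_add:
  assumes "\<And>c d. c \<in> Poly_Mapping.keys p \<Longrightarrow> d \<in> Poly_Mapping.keys q \<Longrightarrow> d < c"
  shows "cnf_value (p + q) = cnf_value p + cnf_value q"
  using assms
proof (induction p rule: poly_mapping_max_induct)
  case (add p c n)
  have keys: "Poly_Mapping.keys (Poly_Mapping.single c n + p) = insert c (Poly_Mapping.keys p)"
    using add.hyps(2) by (rule keys_single_add)
  have "\<forall>k\<in>Poly_Mapping.keys (p + q). k < c"
    using add.hyps add.prems keys keys_add[of p q] by blast
  then show ?case
    using add keys by (simp add: cnf_value_single_add add.assoc)
qed simp

lemma lookup_le_cnf_value: "opow \<omega> c * ordinal_of_nat (Poly_Mapping.lookup p c) \<le> cnf_value p"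
proof (induction p rule: poly_mapping_max_induct)
  case (add p d n)
  show ?case
  proof (cases "c = d")
    case True
    then have "Poly_Mapping.lookup p c = 0"
      using add by (auto simp flip: not_in_keys_iff_lookup_eq_zero)
    then show ?thesis
      using True add by (simp add: cnf_value_single_add lookup_add)
  next
    case False
    then show ?thesis
      using add by (simp add: cnf_value_single_add lookup_add lookup_single when_def)
        (meson le_add_left_ordinal order_trans)
  qed
qed simp

lemma opow_omega_le_times: "0 < n \<Longrightarrow> opow \<omega> c \<le> opow \<omega> c * ordinal_of_nat n"
  by (cases n) (simp_all flip: osucc_le_iff) 

lemma opow_omega_le_cnf_value:
  "c \<in> Poly_Mapping.keys p \<Longrightarrow> opow \<omega> c \<le> cnf_value p"
  using opow_omega_le_times lookup_le_cnf_value by (metis in_keys_iff neq0_conv order_trans)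

text \<open>The leading exponent controls the size: the tail is below
  \<open>opow \<omega> c\<close>, so the value is below
  \<open>opow \<omega> c * ordinal_of_nat (Suc n)\<close> and hence below the next power.\<close>

lemma cnf_value_less_iff: "cnf_value p < opow \<omega> e \<longleftrightarrow> (\<forall>c\<in>Poly_Mapping.keys p. c < e)"
proof
  assume "cnf_value p < opow \<omega> e"
  then show "\<forall>c\<in>Poly_Mapping.keys p. c < e"
    using opow_omega_le_cnf_value opow_omega_less_iff by (metis order_le_less_trans)
next
  assume "\<forall>c\<in>Poly_Mapping.keys p. c < e"
  then show "cnf_value p < opow \<omega> e"
  proof (induction p arbitrary: e rule: poly_mapping_max_induct)
    case (add p c n)
    then have "c < e"
      by (simp add: in_keys_iff lookup_add)
    have "cnf_value (Poly_Mapping.single c n + p) < opow \<omega> c * ordinal_of_nat n + opow \<omega> c"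
      using add by (simp add: cnf_value_single_add)
    also have "\<dots> = opow \<omega> c * ordinal_of_nat (Suc n)"
      by simp
    also have "\<dots> < opow \<omega> (osucc c)"
      unfolding opow_osucc by (rule times_nat_less_times_omega) simp
    also have "\<dots> \<le> opow \<omega> e"
      using \<open>c < e\<close> by (simp add: osucc_le_iff del: opow_osucc)
    finally show ?case .
  qed simp
qed

text \<open>The upper bound makes every exponent at most \<open>c\<close>; if \<open>c\<close> were
  missing, all would be smaller, against the lower bound.\<close>

lemma mem_keys_if_cnf_value:
  assumes "opow \<omega> c \<le> cnf_value p" "cnf_value p < opow \<omega> (osucc c)"
  shows "c \<in> Poly_Mapping.keys p"
  using assms cnf_value_less_iff[of p] by (metis less_osucc_iff not_less order_le_less)

section \<open>Existence and uniqueness of the normal form\<close>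

lemma ordinal_division_unique:
  assumes "u * q + r = u * q' + r'" "r < u" "r' < (u :: 'a::infinite ordinal)"
  shows "q = q' \<and> r = r'"
proof -
  have "\<not> q < q'" if "u * q + r = u * q' + r'" "r < u" for q q' r r'
  proof
    assume "q < q'"
    have "u * q + r < u * osucc q"
      using that(2) by simp
    also have "\<dots> \<le> u * q'"
      using \<open>q < q'\<close> normal_le_iff[OF normal_times[OF le_less_trans[OF zero_le_ordinal assms(2)]]]
      by (simp add: osucc_le_iff del: times_osucc)
    also have "\<dots> \<le> u * q' + r'"
      by simp
    finally show False
      using that by simp
  qed
  then have "q = q'"
    using assms by (metis linorder_neqE)
  then show ?thesis
    using assms by simp
qed

text \<open>Bracketing \<open>x\<close> between consecutive powers gives the leading exponent
  \<open>c\<close>. The quotient by \<open>opow \<omega> c\<close> is finite, and the remainder is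
  smaller than \<open>x\<close>, so the induction hypothesis supplies the tail.\<close>

lemma cnf_value_surj: "\<exists>p. cnf_value p = x"
proof (induction x rule: less_induct)
  case (less x)
  show ?case
  proof (cases "x = 0")
    case False
    then have "opow \<omega> 0 \<le> x"
      using osucc_le_iff[of 0 x] by (simp add: zero_less_iff_ordinal one_ordinal_def)
    then obtain c where c: "opow \<omega> c \<le> x" "x < opow \<omega> c * \<omega>"
      using normal_bracket[OF normal_opow_omega] by (metis opow_osucc)
    obtain q r where qr: "x = opow \<omega> c * q + r" "r < opow \<omega> c"
      by (rule ordinal_division[OF opow_omega_pos])
    have "opow \<omega> c * q < opow \<omega> c * \<omega>"
      using qr c by (metis le_add_right_ordinal order_le_less_trans)
    then obtain n where n: "q = ordinal_of_nat n"
      by (auto simp: normal_less_iff[OF normal_times] less_omega_iff)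
    obtain p where p: "cnf_value p = r"
      using less c qr by (metis order_less_le_trans)
    then have "\<forall>k\<in>Poly_Mapping.keys p. k < c"
      using qr by (simp flip: cnf_value_less_iff)
    then show ?thesis
      using p n qr by (metis cnf_value_single_add)
  qed (use cnf_value_zero in blast)
qed

lemma cnf_value_zero_iff [simp]: "cnf_value p = 0 \<longleftrightarrow> p = 0"
  using opow_omega_le_cnf_value[of _ p]
  by (metis cnf_value_zero leD opow_omega_pos keys_eq_empty all_not_in_conv)

text \<open>Equal values lie between the same consecutive powers of \<omega>, so the leading
  exponents agree. Uniqueness of division by that power then separates the leading coefficient from
  the tail.\<close>

lemma cnf_value_eq_iff [simp]: "cnf_value p = cnf_value q \<longleftrightarrow> p = q"
proof
  show "p = q" if "cnf_value p = cnf_value q"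
    using that
  proof (induction p arbitrary: q rule: poly_mapping_max_induct)
    case zero
    then show ?case
      by (metis cnf_value_zero_iff cnf_value_zero)
  next
    case (add p c n)
    define v where "v = cnf_value (Poly_Mapping.single c n + p)"
    have v: "v = opow \<omega> c * ordinal_of_nat n + cnf_value p" and p: "cnf_value p < opow \<omega> c"
      using add by (simp_all add: v_def cnf_value_single_add cnf_value_less_iff)
    have "c \<in> Poly_Mapping.keys (Poly_Mapping.single c n + p)"
      using add by (simp add: in_keys_iff lookup_add)
    then have le: "opow \<omega> c \<le> v"
      unfolding v_def by (rule opow_omega_le_cnf_value)
    have less: "v < opow \<omega> (osucc c)"
      unfolding v_def cnf_value_less_iff using add.hyps
      by (auto simp: less_osucc_iff keys_single_add order_less_imp_le)
    have v_eq: "v = cnf_value q"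
      using add.prems by (simp add: v_def)
    then have "q \<noteq> 0"
      using le opow_omega_pos[of c] by (metis cnf_value_zero leD)
    \<comment> \<open>The induction rule serves only as a case distinction here, exposing the
      leading term of \<open>q\<close>.\<close>
    then have "\<exists>q' d m. q = Poly_Mapping.single d m + q' \<and> (\<forall>k\<in>Poly_Mapping.keys q'. k < d) \<and> 0 < m"
      by (induction q rule: poly_mapping_max_induct) blast+
    then obtain q' d m where q: "q = Poly_Mapping.single d m + q'"
      and q': "\<forall>k\<in>Poly_Mapping.keys q'. k < d" and "0 < m"
      by blast
    have "d \<in> Poly_Mapping.keys q"
      using q \<open>0 < m\<close> by (simp add: in_keys_iff lookup_add)
    moreover have "c \<in> Poly_Mapping.keys q" "\<forall>k\<in>Poly_Mapping.keys q. k \<le> c"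
      using le less mem_keys_if_cnf_value cnf_value_less_iff unfolding v_eq less_osucc_iff [symmetric]
      by blast+
    moreover have "\<forall>k\<in>Poly_Mapping.keys q. k \<le> d"
      using q q' \<open>0 < m\<close> by (auto simp: keys_single_add order_less_imp_le)
    ultimately have "d = c"
      by (meson order_antisym)
    then have "opow \<omega> c * ordinal_of_nat n + cnf_value p = opow \<omega> c * ordinal_of_nat m + cnf_value q'"
      "cnf_value q' < opow \<omega> c"
      using v v_eq q q' by (simp_all add: cnf_value_single_add cnf_value_less_iff)
    then have "ordinal_of_nat n = (ordinal_of_nat m :: 'a ordinal)" "cnf_value p = cnf_value q'"
      using ordinal_division_unique[OF _ p] by blast+
    moreover from this have "n = m"
      using ordinal_of_nat_less_iff by (metis less_irrefl linorder_neqE_nat)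
    ultimately show ?case
      using add.IH q \<open>d = c\<close> by blast
  qed
qed simp

lemma cnf_cnf_value [simp]: "cnf (cnf_value p) = p"
  unfolding cnf_def by (rule the_equality) simp_all

lemma cnf_value_cnf [simp]: "cnf_value (cnf x) = x"
  using cnf_value_surj[of x] by auto

lemma cnf_eqI: "cnf_value p = x \<Longrightarrow> cnf x = p"
  by auto

text \<open>Through this injectivity, identities for \<oplus> and \<otimes> are verified on
  coefficient families.\<close>

lemma cnf_inject: "cnf x = cnf y \<Longrightarrow> x = y"
  by (metis cnf_value_cnf)

lemma cnf_0 [simp]: "cnf 0 = 0"
  by (rule cnf_eqI) simp

lemma cnf_opow_omega_times_nat [simp]:
  "cnf (opow \<omega> c * ordinal_of_nat n) = Poly_Mapping.single c n"
  by (rule cnf_eqI) (rule cnf_value_single)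

lemma cnf_opow_omega [simp]: "cnf (opow \<omega> c) = Poly_Mapping.single c 1"
  using cnf_opow_omega_times_nat[of c 1] by (simp only: ordinal_of_nat_1 times_one_ordinal)

lemma cnf_ordinal_of_nat [simp]: "cnf (ordinal_of_nat n) = Poly_Mapping.single 0 n"
  using cnf_opow_omega_times_nat[of 0 n] by simp

lemma less_opow_omega_iff: "x < opow \<omega> e \<longleftrightarrow> (\<forall>c\<in>Poly_Mapping.keys (cnf x). c < e)"
  using cnf_value_less_iff[of "cnf x" e] by simp


section \<open>Natural sum\<close>

lemma cnf_natural_sum [simp]: "cnf (x \<oplus> y) = cnf x + cnf y"
  by (simp add: natural_sum_def)

interpretation natural_sum: comm_monoid "(\<oplus>)" "0 :: 'a::infinite ordinal"
  by unfold_locales (rule cnf_inject, simp add: ac_simps)+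

lemma natural_sum_less_opow_omega:
  "x < opow \<omega> e \<Longrightarrow> y < opow \<omega> e \<Longrightarrow> x \<oplus> y < opow \<omega> e"
  using keys_add[of "cnf x" "cnf y"] by (auto simp: less_opow_omega_iff)

text \<open>
  In the semiring structure on \<^typ>\<open>'a cnf\<close>, exponents are added by ordinary ordinal addition.
\<close>

lemma cnf_opow_omega_times:
  "cnf (opow \<omega> e * x) = Poly_Mapping.single e 1 * cnf x"
proof (rule cnf_eqI)
  have "cnf_value (Poly_Mapping.single e 1 * p) = opow \<omega> e * cnf_value p" for p :: "'a cnf"
  proof (induction p rule: poly_mapping_max_induct)
    case (add p c n)
    have "\<forall>k\<in>Poly_Mapping.keys (Poly_Mapping.single e 1 * p). k < e + c"
      using add.hyps keys_mult[of "Poly_Mapping.single e 1" p] by fastforce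
    then show ?case
      using add by (simp add: distrib_left mult_single cnf_value_single_add times_add_ordinal
          opow_omega_add times_assoc_ordinal)
  qed simp
  then show "cnf_value (Poly_Mapping.single e 1 * cnf x) = opow \<omega> e * x"
    by simp
qed

lemma opow_omega_times_natural_sum:
  "opow \<omega> e * (x \<oplus> y) = opow \<omega> e * x \<oplus> opow \<omega> e * y"
  by (rule cnf_inject) (simp add: cnf_opow_omega_times distrib_left)

text \<open>The exponents of \<open>opow \<omega> e * x\<close> have the form \<open>e + c'\<close>,
  so they are at least \<open>e\<close>, while those of \<open>r\<close> are below \<open>e\<close>:
  adding the normal forms merely concatenates them.\<close>

lemma natural_sum_eq_add:
  assumes "r < opow \<omega> e"
  shows "opow \<omega> e * x \<oplus> r = opow \<omega> e * x + r"
proof -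
  have "d < c" if c: "c \<in> Poly_Mapping.keys (cnf (opow \<omega> e * x))" and d: "d \<in> Poly_Mapping.keys (cnf r)" for c d
  proof -
    have "\<exists>c'. c = e + c'"
      using c keys_mult[of "Poly_Mapping.single e 1" "cnf x"] unfolding cnf_opow_omega_times
      by (auto split: if_splits)
    moreover have "d < e"
      using assms d by (simp add: less_opow_omega_iff)
    ultimately show ?thesis
      using le_add_right_ordinal by (metis order_less_le_trans)
  qed
  then have "cnf_value (cnf (opow \<omega> e * x) + cnf r) = opow \<omega> e * x + r"
    by (subst cnf_value_add) auto
  then show ?thesis
    by (simp add: natural_sum_def)
qed

lemma natural_sum_ordinal_of_nat: "ordinal_of_nat m \<oplus> ordinal_of_nat n = ordinal_of_nat (m + n)"
  by (rule cnf_inject) (simp add: single_add)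

lemma omega_times_add_nat:
  "\<omega> * x + ordinal_of_nat n = \<omega> * x \<oplus> ordinal_of_nat n"
  using natural_sum_eq_add[of "ordinal_of_nat n" 1 x] by simp

lemma natural_sum_omega_times_add_nat:
  "(\<omega> * x + ordinal_of_nat m) \<oplus> (\<omega> * y + ordinal_of_nat n) =
    \<omega> * (x \<oplus> y) + ordinal_of_nat (m + n)"
  using opow_omega_times_natural_sum[of 1 x y]
  unfolding omega_times_add_nat
  by (simp add: natural_sum.assoc natural_sum.left_commute flip: natural_sum_ordinal_of_nat)


section \<open>Natural product\<close>

text \<open>The product \<open>*\<close> on \<open>'a cnf\<close> adds exponents by the
  noncommutative \<open>+\<close>; this is its counterpart with exponents added by \<oplus>.\<close>

definition cnf_mult :: "'a::infinite cnf \<Rightarrow> 'a cnf \<Rightarrow> 'a cnf"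
  where "cnf_mult p q = (\<Sum>c\<in>Poly_Mapping.keys p. \<Sum>d\<in>Poly_Mapping.keys q.
    Poly_Mapping.single (c \<oplus> d) (Poly_Mapping.lookup p c * Poly_Mapping.lookup q d))"

text \<open>The double list comprehension is a \<open>concat\<close>, so its natural sum is a double
  list sum; distinctness of the exponent lists turns it into sums over key sets.\<close>

lemma cnf_natural_prod [simp]: "cnf (x \<otimes> y) = cnf_mult (cnf x) (cnf y)"
proof -
  have "cnf (foldr (\<oplus>) xs 0) = (\<Sum>x\<leftarrow>xs. cnf x)" for xs :: "'a ordinal list"
    by (induction xs) simp_all
  moreover have "(\<Sum>x\<leftarrow>concat xss. cnf x) = (\<Sum>xs\<leftarrow>xss. \<Sum>x\<leftarrow>xs. cnf x)"
    for xss :: "'a ordinal list list"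
    by (induction xss) simp_all
  ultimately show ?thesis
    by (simp add: natural_prod_def cnf_mult_def o_def sum_list_distinct_conv_sum_set)
qed

text \<open>Pairs outside the supports contribute zero. A common index set for several families
  makes the sum visibly additive in \<open>cnf_mult_add_left\<close>.\<close>

lemma cnf_mult_superset:
  assumes "finite A" "Poly_Mapping.keys p \<subseteq> A" "finite B" "Poly_Mapping.keys q \<subseteq> B"
  shows "cnf_mult p q = (\<Sum>c\<in>A. \<Sum>d\<in>B.
    Poly_Mapping.single (c \<oplus> d) (Poly_Mapping.lookup p c * Poly_Mapping.lookup q d))"
proof -
  have "cnf_mult p q = (\<Sum>c\<in>A. \<Sum>d\<in>Poly_Mapping.keys q.
      Poly_Mapping.single (c \<oplus> d) (Poly_Mapping.lookup p c * Poly_Mapping.lookup q d))"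
    unfolding cnf_mult_def using assms
    by (intro sum.mono_neutral_left) (auto simp: in_keys_iff)
  also have "\<dots> = (\<Sum>c\<in>A. \<Sum>d\<in>B.
      Poly_Mapping.single (c \<oplus> d) (Poly_Mapping.lookup p c * Poly_Mapping.lookup q d))"
    using assms by (intro sum.cong refl sum.mono_neutral_left) (auto simp: in_keys_iff)
  finally show ?thesis .
qed

lemma cnf_mult_commute: "cnf_mult p q = cnf_mult q p"
  unfolding cnf_mult_def by (subst sum.swap) (simp add: natural_sum.commute mult.commute)

lemma cnf_mult_zero_left [simp]: "cnf_mult 0 q = 0"
  by (simp add: cnf_mult_def)

lemma cnf_mult_zero_right [simp]: "cnf_mult p 0 = 0"
  by (simp add: cnf_mult_def)

lemma cnf_mult_add_left: "cnf_mult (p + p') q = cnf_mult p q + cnf_mult p' q"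
proof -
  let ?A = "Poly_Mapping.keys p \<union> Poly_Mapping.keys p'" and ?B = "Poly_Mapping.keys q"
  have "cnf_mult r q = (\<Sum>c\<in>?A. \<Sum>d\<in>?B.
      Poly_Mapping.single (c \<oplus> d) (Poly_Mapping.lookup r c * Poly_Mapping.lookup q d))"
    if "Poly_Mapping.keys r \<subseteq> ?A" for r
    by (rule cnf_mult_superset) (use that in auto)
  moreover have "Poly_Mapping.keys (p + p') \<subseteq> ?A"
    by (rule keys_add)
  ultimately show ?thesis
    by (simp add: lookup_add distrib_right single_add sum.distrib)
qed

lemma cnf_mult_add_right: "cnf_mult p (q + q') = cnf_mult p q + cnf_mult p q'"
  using cnf_mult_add_left cnf_mult_commute by metis

lemma cnf_mult_single [simp]:
  "cnf_mult (Poly_Mapping.single c m) (Poly_Mapping.single d n) = Poly_Mapping.single (c \<oplus> d) (m * n)"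
  by (subst cnf_mult_superset[of "{c}" _ "{d}"]) auto

text \<open>Additivity in each argument reduces the claim to single terms, where it is associativity
  of \<oplus> on exponents and of multiplication on coefficients.\<close>

lemma cnf_mult_assoc: "cnf_mult (cnf_mult p q) r = cnf_mult p (cnf_mult q r)"
proof (induction p rule: poly_mapping_max_induct)
  case (add p c n)
  have "cnf_mult (cnf_mult (Poly_Mapping.single c n) q) r =
      cnf_mult (Poly_Mapping.single c n) (cnf_mult q r)"
  proof (induction q rule: poly_mapping_max_induct)
    case (add q d m)
    have "cnf_mult (cnf_mult (Poly_Mapping.single c n) (Poly_Mapping.single d m)) r =
        cnf_mult (Poly_Mapping.single c n) (cnf_mult (Poly_Mapping.single d m) r)"
      by (induction r rule: poly_mapping_max_induct)
        (simp_all add: cnf_mult_add_right natural_sum.assoc mult.assoc)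
    then show ?case
      using add by (simp add: cnf_mult_add_left cnf_mult_add_right del: cnf_mult_single)
  qed simp
  then show ?case
    using add by (simp add: cnf_mult_add_left)
qed simp

lemma cnf_mult_one_right: "cnf_mult p (Poly_Mapping.single 0 1) = p"
  by (induction p rule: poly_mapping_max_induct) (simp_all add: cnf_mult_add_left del: single_one)

lemma cnf_1: "cnf 1 = Poly_Mapping.single 0 1"
  using cnf_ordinal_of_nat[of 1] by (simp only: ordinal_of_nat_1)

interpretation natural_prod: comm_monoid "(\<otimes>)" "1 :: 'a::infinite ordinal"
proof
  fix x y z :: "'a ordinal"
  show "x \<otimes> y \<otimes> z = x \<otimes> (y \<otimes> z)"
    by (rule cnf_inject) (simp add: cnf_mult_assoc)
  show "x \<otimes> y = y \<otimes> x"
    by (rule cnf_inject) (simp add: cnf_mult_commute)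
  show "x \<otimes> 1 = x"
    by (rule cnf_inject) (simp only: cnf_natural_prod cnf_1 cnf_mult_one_right)
qed

lemma natural_prod_opow_omega: "opow \<omega> x \<otimes> opow \<omega> y = opow \<omega> (x \<oplus> y)"
  by (rule cnf_inject) simp

lemma natural_prod_ordinal_of_nat: "ordinal_of_nat m \<otimes> ordinal_of_nat n = ordinal_of_nat (m * n)"
  by (rule cnf_inject) simp

section \<open>Exponents of a natural product\<close>

lemma mem_keys_cnf_multE:
  assumes "k \<in> Poly_Mapping.keys (cnf_mult p q)"
  obtains c d where "c \<in> Poly_Mapping.keys p" "d \<in> Poly_Mapping.keys q" "k = c \<oplus> d"
proof -
  have "(\<Sum>c\<in>Poly_Mapping.keys p. \<Sum>d\<in>Poly_Mapping.keys q.
      Poly_Mapping.lookup (Poly_Mapping.single (c \<oplus> d) (Poly_Mapping.lookup p c * Poly_Mapping.lookup q d)) k) \<noteq> 0"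
    using assms by (simp add: in_keys_iff cnf_mult_def lookup_sum)
  then show ?thesis
    using that by (elim sum.not_neutral_contains_not_neutral) (auto simp: lookup_single when_def split: if_splits)
qed

text \<open>Coefficients are natural numbers, so nothing cancels: the product of the two selected
  terms is a summand of the whole product.\<close>

lemma lookup_cnf_mult_ge:
  "Poly_Mapping.lookup p c * Poly_Mapping.lookup q d \<le> Poly_Mapping.lookup (cnf_mult p q) (c \<oplus> d)"
proof -
  obtain p' where p: "p = Poly_Mapping.single c (Poly_Mapping.lookup p c) + p'" (is "p = ?c + p'")
    by (rule poly_mapping_decompose)
  obtain q' where q: "q = Poly_Mapping.single d (Poly_Mapping.lookup q d) + q'" (is "q = ?d + q'")
    by (rule poly_mapping_decompose)
  have "cnf_mult p q = cnf_mult (?c + p') q"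
    by (simp flip: p)
  also have "\<dots> = cnf_mult ?c (?d + q') + cnf_mult p' q"
    by (simp add: cnf_mult_add_left flip: q)
  finally show ?thesis
    by (simp add: cnf_mult_add_right lookup_add)
qed

lemma mem_keys_cnf_mult:
  assumes "c \<in> Poly_Mapping.keys p" "d \<in> Poly_Mapping.keys q"
  shows "c \<oplus> d \<in> Poly_Mapping.keys (cnf_mult p q)"
  using assms lookup_cnf_mult_ge[of p c q d] by (metis in_keys_iff le_zero_eq mult_is_0)


section \<open>Super-Jacobsthal exponentiation\<close>

lemma super_jacobsthal_add_nat:
  "x ^\<otimes> (y + ordinal_of_nat n) = x ^\<otimes> y \<otimes> x ^\<otimes> ordinal_of_nat n"
  by (induction n) (simp_all add: super_jacobsthal_0 super_jacobsthal_osucc natural_prod.assoc)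

section \<open>Values at multiples of \<omega>\<close>

lemma omega_division:
  obtains z n where "x = \<omega> * z + ordinal_of_nat n"
proof -
  obtain z r where "x = \<omega> * z + r" "r < \<omega>"
    by (rule ordinal_division[OF zero_less_omega])
  then show ?thesis
    using that by (auto simp: less_omega_iff)
qed

text \<open>With \<open>omega_times_add_nat_less\<close> this describes the index set of the
  supremum at the limit \<open>\<omega> * x\<close>.\<close>

lemma less_omega_times:
  assumes "y < \<omega> * x"
  shows "\<exists>z<x. \<exists>n. y = \<omega> * z + ordinal_of_nat n"
proof -
  obtain z n where y: "y = \<omega> * z + ordinal_of_nat n"
    by (rule omega_division)
  then have "\<omega> * z < \<omega> * x"
    using assms by (metis le_add_right_ordinal order_le_less_trans)
  then have "z < x"
    by (simp add: normal_less_iff[OF normal_times])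
  then show ?thesis
    using y by blast
qed

lemma omega_times_add_nat_less: "z < x \<Longrightarrow> \<omega> * z + ordinal_of_nat n < \<omega> * x"
proof -
  assume "z < x"
  have "\<omega> * z + ordinal_of_nat n < \<omega> * osucc z"
    by simp
  also have "\<dots> \<le> \<omega> * x"
    using \<open>z < x\<close> by (simp add: normal_le_iff[OF normal_times] osucc_le_iff del: times_osucc)
  finally show ?thesis .
qed

lemma limit_ordinal_omega_times:
  assumes "x \<noteq> 0"
  shows "limit_ordinal (\<omega> * x)"
proof (rule limit_ordinalI)
  show "\<omega> * x \<noteq> 0"
    using assms times_pos_ordinal[OF zero_less_omega] by (simp add: zero_less_iff_ordinal)
  show "osucc y < \<omega> * x" if y: "y < \<omega> * x" for y
  proof -
    obtain z n where "z < x" "y = \<omega> * z + ordinal_of_nat n"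
      using less_omega_times[OF y] by blast
    then show ?thesis
      using omega_times_add_nat_less[of z x "Suc n"] by simp
  qed
qed

text \<open>For \<open>z \<noteq> 0\<close> the assumptions make \<open>g z\<close> the supremum of
  all \<open>g y \<otimes> x ^\<otimes> ordinal_of_nat n\<close> with \<open>y < z\<close>. By
  induction these are the values of the exponential at
  \<open>\<omega> * y + ordinal_of_nat n\<close>, and such ordinals exhaust those below the limit
  \<open>\<omega> * z\<close>.\<close>

lemma super_jacobsthal_omega_times:
  assumes zero: "g 0 = 1"
    and upper: "\<And>y z n. y < z \<Longrightarrow> g y \<otimes> x ^\<otimes> ordinal_of_nat n \<le> g z"
    and least: "\<And>w z. z \<noteq> 0 \<Longrightarrow> w < g z \<Longrightarrow> \<exists>y<z. \<exists>n. w < g y \<otimes> x ^\<otimes> ordinal_of_nat n"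
  shows "x ^\<otimes> (\<omega> * z) = g z"
proof (induction z rule: less_induct)
  case (less z)
  show ?case
  proof (cases "z = 0")
    case False
    have step: "x ^\<otimes> (\<omega> * y + ordinal_of_nat n) = g y \<otimes> x ^\<otimes> ordinal_of_nat n" if "y < z" for y n
      using less that by (simp add: super_jacobsthal_add_nat)
    have eq: "x ^\<otimes> (\<omega> * z) = (SUP y\<in>{..<\<omega> * z}. x ^\<otimes> y)"
      by (rule super_jacobsthal_limit[OF limit_ordinal_omega_times[OF False]])
    have "0 \<in> {..<\<omega> * z}"
      using times_pos_ordinal[OF zero_less_omega, of z] False by (simp add: zero_less_iff_ordinal)
    then have "x ^\<otimes> (\<omega> * z) \<le> g z"
      unfolding eq using step upper by (intro cSUP_least) (auto dest: less_omega_times)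
    moreover have "\<not> x ^\<otimes> (\<omega> * z) < g z"
    proof
      assume "x ^\<otimes> (\<omega> * z) < g z"
      then obtain y n where y: "y < z" and "x ^\<otimes> (\<omega> * z) < g y \<otimes> x ^\<otimes> ordinal_of_nat n"
        using least[OF False] by blast
      moreover have "g y \<otimes> x ^\<otimes> ordinal_of_nat n \<le> x ^\<otimes> (\<omega> * z)"
        unfolding eq step[OF y, symmetric]
        by (rule cSUP_upper) (simp_all add: bdd_above_image_lessThan_ordinal omega_times_add_nat_less[OF y])
      ultimately show False
        by simp
    qed
    ultimately show ?thesis
      by (meson not_less order_antisym)
  qed (simp add: zero super_jacobsthal_0)
qed

lemma super_jacobsthal_natural_sum_if:
  assumes omega_times: "\<And>z. x ^\<otimes> (\<omega> * z) = g z"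
    and g: "\<And>y z. g (y \<oplus> z) = g y \<otimes> g z"
  shows "x ^\<otimes> (y \<oplus> z) = x ^\<otimes> y \<otimes> x ^\<otimes> z"
proof -
  obtain y' m where y: "y = \<omega> * y' + ordinal_of_nat m"
    by (rule omega_division)
  obtain z' n where z: "z = \<omega> * z' + ordinal_of_nat n"
    by (rule omega_division)
  have "x ^\<otimes> (y \<oplus> z) = g y' \<otimes> g z' \<otimes> x ^\<otimes> ordinal_of_nat (m + n)"
    unfolding y z natural_sum_omega_times_add_nat by (simp only: super_jacobsthal_add_nat omega_times g)
  also have "x ^\<otimes> ordinal_of_nat (m + n) = x ^\<otimes> ordinal_of_nat m \<otimes> x ^\<otimes> ordinal_of_nat n"
    by (simp only: ordinal_of_nat_add super_jacobsthal_add_nat)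
  also have "g y' \<otimes> g z' \<otimes> \<dots> = x ^\<otimes> y \<otimes> x ^\<otimes> z"
    unfolding y z super_jacobsthal_add_nat omega_times
    by (simp add: natural_prod.assoc natural_prod.left_commute)
  finally show ?thesis .
qed

text \<open>The ordinals below \<open>opow \<omega> e\<close> are closed under \<oplus>, so the
  exponents in the finite powers of \<open>x\<close> never leave this bound.\<close>

lemma super_jacobsthal_nat_less:
  assumes "x < opow \<omega> (opow \<omega> e)"
  shows "x ^\<otimes> ordinal_of_nat n < opow \<omega> (opow \<omega> e)"
proof (induction n)
  case 0
  then show ?case
    using opow_omega_less_iff[of 0 "opow \<omega> e"] by (simp add: super_jacobsthal_0 del: opow_omega_less_iff)
next
  case (Suc n)
  have "c < opow \<omega> e" if "c \<in> Poly_Mapping.keys (cnf_mult (cnf (x ^\<otimes> ordinal_of_nat n)) (cnf x))" for c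
    using that Suc assms less_opow_omega_iff natural_sum_less_opow_omega
    by (metis mem_keys_cnf_multE)
  then show ?case
    by (simp add: super_jacobsthal_osucc less_opow_omega_iff[of "_ \<otimes> _"])
qed

text \<open>The second alternative in \<open>cofinal\<close> is for finite bases, whose only
  exponent is 0, so that growth occurs in the coefficient alone. For infinite bases the exponents
  themselves pass every \<open>z\<close>.\<close>

lemma super_jacobsthal_natural_sum_if_cofinal:
  fixes x e :: "'a::infinite ordinal"
  assumes x: "x < opow \<omega> (opow \<omega> e)"
    and cofinal: "\<And>z m. z < opow \<omega> e \<Longrightarrow> \<exists>n. \<exists>d\<in>Poly_Mapping.keys (cnf (x ^\<otimes> ordinal_of_nat n)).
      z < d \<or> z = d \<and> m \<le> Poly_Mapping.lookup (cnf (x ^\<otimes> ordinal_of_nat n)) d"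
  shows "x ^\<otimes> (\<beta> \<oplus> \<gamma>) = x ^\<otimes> \<beta> \<otimes> x ^\<otimes> \<gamma>"
proof (rule super_jacobsthal_natural_sum_if)
  let ?u = "opow \<omega> e"
  let ?g = "\<lambda>y. opow \<omega> (?u * y)"
  show "?g (y \<oplus> z) = ?g y \<otimes> ?g z" for y z
    by (simp add: opow_omega_times_natural_sum natural_prod_opow_omega)
  have key_less: "d < ?u" if "d \<in> Poly_Mapping.keys (cnf (x ^\<otimes> ordinal_of_nat n))" for d n
    using that super_jacobsthal_nat_less[OF x, of n] by (simp add: less_opow_omega_iff)
  show "x ^\<otimes> (\<omega> * z) = ?g z" for z
  proof (rule super_jacobsthal_omega_times)
    fix y z :: "'a ordinal" and n
    assume "y < z"
    \<comment> \<open>The exponents of the product are \<open>?u * y \<oplus> d = ?u * y + d\<close>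
      with \<open>d < ?u\<close>, hence below \<open>?u * osucc y\<close>.\<close>
    have "?g y \<otimes> x ^\<otimes> ordinal_of_nat n < ?g (osucc y)"
      unfolding less_opow_omega_iff cnf_natural_prod
      by (auto elim!: mem_keys_cnf_multE split: if_splits simp: key_less natural_sum_eq_add)
    also have "\<dots> \<le> ?g z"
      using \<open>y < z\<close> by (simp add: normal_le_iff[OF normal_times] osucc_le_iff del: times_osucc)
    finally show "?g y \<otimes> x ^\<otimes> ordinal_of_nat n \<le> ?g z"
      by simp
  next
    fix w z :: "'a ordinal"
    assume "z \<noteq> 0" and w: "w < ?g z"
    then have "?u * z \<noteq> 0"
      using times_pos_ordinal[OF opow_omega_pos, of z] by (simp add: zero_less_iff_ordinal)
    \<comment> \<open>Once \<open>w\<close> is below a finite multiple of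
      \<open>opow \<omega> v\<close>, division of \<open>v\<close> by \<open>?u\<close> yields the
      witness \<open>y\<close> and a remainder \<open>r\<close>, at which \<open>cofinal\<close>
      selects the finite power.\<close>
    then obtain v m where v: "v < ?u * z" and wv: "w < opow \<omega> v * ordinal_of_nat m"
      using less_opow_omega[OF w] by blast
    obtain y r where vy: "v = ?u * y + r" and r: "r < ?u"
      by (rule ordinal_division[OF opow_omega_pos])
    have "?u * y < ?u * z"
      using v unfolding vy by (meson le_add_right_ordinal order_le_less_trans)
    then have "y < z"
      by (simp add: normal_less_iff[OF normal_times])
    obtain n d where d: "d \<in> Poly_Mapping.keys (cnf (x ^\<otimes> ordinal_of_nat n))"
      and cases: "r < d \<or> r = d \<and> m \<le> Poly_Mapping.lookup (cnf (x ^\<otimes> ordinal_of_nat n)) d"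
      using cofinal[OF r] by blast
    let ?p = "cnf (?g y \<otimes> x ^\<otimes> ordinal_of_nat n)"
    have p: "?p = cnf_mult (Poly_Mapping.single (?u * y) 1) (cnf (x ^\<otimes> ordinal_of_nat n))"
      by simp
    have yd: "?u * y \<oplus> d = ?u * y + d"
      by (rule natural_sum_eq_add[OF key_less[OF d]])
    have "opow \<omega> v * ordinal_of_nat m \<le> cnf_value ?p"
      using cases
    proof (elim disjE conjE)
      assume "r < d"
      \<comment> \<open>The product has the exponent \<open>?u * y + d\<close> above
        \<open>v\<close>, which dominates every finite multiple of
        \<open>opow \<omega> v\<close>.\<close>
      have "opow \<omega> v * ordinal_of_nat m \<le> opow \<omega> (osucc v)"
        by (simp add: less_imp_le times_nat_less_times_omega)
      also have "\<dots> \<le> opow \<omega> (?u * y + d)"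
        unfolding opow_omega_le_iff vy using \<open>r < d\<close> by (simp add: osucc_le_iff)
      also have "\<dots> \<le> cnf_value ?p"
        unfolding p yd[symmetric] using d
        by (intro opow_omega_le_cnf_value mem_keys_cnf_mult) simp_all
      finally show ?thesis .
    next
      assume "r = d" and m: "m \<le> Poly_Mapping.lookup (cnf (x ^\<otimes> ordinal_of_nat n)) d"
      \<comment> \<open>Here \<open>v\<close> itself is an exponent of the product, with coefficient
        at least \<open>m\<close>.\<close>
      have "m \<le> Poly_Mapping.lookup ?p (?u * y \<oplus> d)"
        using m lookup_cnf_mult_ge[of "Poly_Mapping.single (?u * y) 1" "?u * y" "cnf (x ^\<otimes> ordinal_of_nat n)" d]
        unfolding p by simp
      then have "opow \<omega> v * ordinal_of_nat m \<le>
          opow \<omega> v * ordinal_of_nat (Poly_Mapping.lookup ?p (?u * y \<oplus> d))"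
        by (simp add: normal_le_iff[OF normal_times])
      also have "\<dots> \<le> cnf_value ?p"
        unfolding vy \<open>r = d\<close> yd by (rule lookup_le_cnf_value)
      finally show ?thesis .
    qed
    then have "w < ?g y \<otimes> x ^\<otimes> ordinal_of_nat n"
      unfolding cnf_value_cnf by (rule order_less_le_trans[OF wv])
    then show "\<exists>y<z. \<exists>n. w < ?g y \<otimes> x ^\<otimes> ordinal_of_nat n"
      using \<open>y < z\<close> by blast
  qed simp
qed

section \<open>Finite bases\<close>

lemma super_jacobsthal_nat:
  "ordinal_of_nat a ^\<otimes> ordinal_of_nat n = ordinal_of_nat (a ^ n)"
proof (induction n)
  case 0
  then show ?case
    by (simp add: super_jacobsthal_0 one_ordinal_def)
next
  case (Suc n)
  then show ?case
    by (simp add: super_jacobsthal_osucc natural_prod_ordinal_of_nat mult.commute)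
qed

text \<open>Base 0 behaves like base 1 at multiples of \<omega>: the value 1 at exponent 0 enters
  every supremum.\<close>

lemma super_jacobsthal_natural_sum_le_one:
  fixes \<beta> \<gamma> :: "'a::infinite ordinal"
  assumes "a \<le> 1"
  shows "ordinal_of_nat a ^\<otimes> (\<beta> \<oplus> \<gamma>) = ordinal_of_nat a ^\<otimes> \<beta> \<otimes> ordinal_of_nat a ^\<otimes> \<gamma>"
proof (rule super_jacobsthal_natural_sum_if)
  show "ordinal_of_nat a ^\<otimes> (\<omega> * z) = 1" for z :: "'a ordinal"
  proof (rule super_jacobsthal_omega_times)
    show "1 \<otimes> ordinal_of_nat a ^\<otimes> ordinal_of_nat n \<le> (1 :: 'a ordinal)" for n
      using assms power_le_one[of a n] unfolding ordinal_of_nat_1[symmetric] super_jacobsthal_nat natural_prod_ordinal_of_nat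
      by (simp del: ordinal_of_nat_Suc)
    show "\<exists>y<z. \<exists>n. w < 1 \<otimes> ordinal_of_nat a ^\<otimes> ordinal_of_nat n"
      if "z \<noteq> 0" "w < 1" for w z :: "'a ordinal"
    proof -
      \<comment> \<open>The choice \<open>n = 0\<close> serves both bases, as the positive finite
        powers of 0 vanish.\<close>
      have "w < 1 \<otimes> ordinal_of_nat a ^\<otimes> ordinal_of_nat 0"
        using \<open>w < 1\<close> by (simp add: super_jacobsthal_0)
      then show ?thesis
        using \<open>z \<noteq> 0\<close> zero_less_iff_ordinal by blast
    qed
  qed simp
qed simp

lemma super_jacobsthal_natural_sum_nat:
  fixes \<beta> \<gamma> :: "'a::infinite ordinal"
  assumes "2 \<le> a"
  shows "ordinal_of_nat a ^\<otimes> (\<beta> \<oplus> \<gamma>) = ordinal_of_nat a ^\<otimes> \<beta> \<otimes> ordinal_of_nat a ^\<otimes> \<gamma>"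
proof (rule super_jacobsthal_natural_sum_if_cofinal[where e = 0])
  fix z :: "'a ordinal" and m
  assume "z < opow \<omega> 0"
  then have "z = 0"
    by (simp add: one_ordinal_def less_osucc_iff order_antisym)
  \<comment> \<open>The only exponent available is 0, so cofinality must come from the coefficient
    \<open>a ^ m\<close> of the \<open>m\<close>-th power.\<close>
  have "m < a ^ m"
    using assms by (intro power_gt_expt) simp
  then show "\<exists>n. \<exists>d\<in>Poly_Mapping.keys (cnf (ordinal_of_nat a ^\<otimes> ordinal_of_nat n)).
      z < d \<or> z = d \<and> m \<le> Poly_Mapping.lookup (cnf (ordinal_of_nat a ^\<otimes> ordinal_of_nat n)) d"
    using assms \<open>z = 0\<close> by (intro exI[of _ m]) (simp add: super_jacobsthal_nat)
qed simp

section \<open>Infinite bases\<close>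

lemma super_jacobsthal_natural_sum_infinite:
  assumes "\<omega> \<le> x"
  shows "x ^\<otimes> (\<beta> \<oplus> \<gamma>) = x ^\<otimes> \<beta> \<otimes> x ^\<otimes> \<gamma>"
proof -
  have "opow \<omega> 1 \<le> x"
    using assms by simp
  \<comment> \<open>The leading exponent \<open>a\<close> of \<open>x\<close> is positive because
    \<open>x\<close> is infinite, so it has a leading exponent \<open>b\<close> in turn.\<close>
  then obtain a where a: "opow \<omega> a \<le> x" "x < opow \<omega> (osucc a)"
    using normal_bracket[OF normal_opow_omega, of x] opow_omega_le_iff[of 0 1] by (metis order_trans zero_le_ordinal)
  then have "1 \<le> a"
    using \<open>opow \<omega> 1 \<le> x\<close> by (meson less_osucc_iff opow_omega_less_iff order_le_less_trans)
  then have "opow \<omega> 0 \<le> a"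
    by simp
  then obtain b where b: "opow \<omega> b \<le> a" "a < opow \<omega> (osucc b)"
    using normal_bracket[OF normal_opow_omega] by blast
  have a_key: "a \<in> Poly_Mapping.keys (cnf x)"
    by (rule mem_keys_if_cnf_value) (use a in simp_all)
  have b_key: "b \<in> Poly_Mapping.keys (cnf a)"
    by (rule mem_keys_if_cnf_value) (use b in simp_all)
  \<comment> \<open>The \<open>n\<close>-fold natural sum of \<open>a\<close> is an exponent of the
    \<open>n\<close>-th power, and its coefficient at \<open>b\<close> is at least
    \<open>n\<close>.\<close>
  have multiple: "\<exists>d\<in>Poly_Mapping.keys (cnf (x ^\<otimes> ordinal_of_nat n)). n \<le> Poly_Mapping.lookup (cnf d) b" for n
  proof (induction n)
    case 0
    then show ?case
      by (simp add: super_jacobsthal_0 cnf_1)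
  next
    case (Suc n)
    then obtain d where "d \<in> Poly_Mapping.keys (cnf (x ^\<otimes> ordinal_of_nat n))" "n \<le> Poly_Mapping.lookup (cnf d) b"
      by blast
    moreover have "0 < Poly_Mapping.lookup (cnf a) b"
      using b_key by (simp add: in_keys_iff)
    ultimately show ?case
      using a_key by (intro bexI[of _ "d \<oplus> a"])
        (auto simp: super_jacobsthal_osucc lookup_add intro: mem_keys_cnf_mult)
  qed
  show ?thesis
  proof (rule super_jacobsthal_natural_sum_if_cofinal[where e = "osucc b"])
    \<comment> \<open>From \<open>a < opow \<omega> (osucc b)\<close> follows
      \<open>osucc a \<le> opow \<omega> (osucc b)\<close>, and \<open>x\<close> is below
      \<open>opow \<omega> (osucc a)\<close>.\<close>
    show "x < opow \<omega> (opow \<omega> (osucc b))"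
      using a(2) by (rule order_less_le_trans) (use b(2) in \<open>simp only: opow_omega_le_iff osucc_le_iff\<close>)
    fix z :: "'a ordinal" and m
    assume "z < opow \<omega> (osucc b)"
    \<comment> \<open>The finite multiples of \<open>opow \<omega> b\<close> are cofinal in the next
      power, so an exponent with a large coefficient at \<open>b\<close> passes
      \<open>z\<close>.\<close>
    then obtain n where n: "z < opow \<omega> b * ordinal_of_nat n"
      using less_times_omega[OF opow_omega_pos] by auto
    obtain d where d: "d \<in> Poly_Mapping.keys (cnf (x ^\<otimes> ordinal_of_nat n))"
      and "n \<le> Poly_Mapping.lookup (cnf d) b"
      using multiple by blast
    then have "opow \<omega> b * ordinal_of_nat n \<le> opow \<omega> b * ordinal_of_nat (Poly_Mapping.lookup (cnf d) b)"
      by (simp add: normal_le_iff[OF normal_times])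
    also have "\<dots> \<le> d"
      using lookup_le_cnf_value[of b "cnf d"] by simp
    finally have "z < d"
      using n by simp
    then show "\<exists>n. \<exists>d\<in>Poly_Mapping.keys (cnf (x ^\<otimes> ordinal_of_nat n)).
        z < d \<or> z = d \<and> m \<le> Poly_Mapping.lookup (cnf (x ^\<otimes> ordinal_of_nat n)) d"
      using d by blast
  qed
qed

theorem theorem1p10:
  fixes \<alpha> \<beta> \<gamma> :: "'a::infinite ordinal"
  shows "\<alpha> ^\<otimes> (\<beta> \<oplus> \<gamma>) = (\<alpha> ^\<otimes> \<beta>) \<otimes> (\<alpha> ^\<otimes> \<gamma>)"
proof (cases "\<alpha> < \<omega>")
  case True
  then obtain a where "\<alpha> = ordinal_of_nat a"
    by (auto simp: less_omega_iff)
  then show ?thesis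
    using super_jacobsthal_natural_sum_le_one super_jacobsthal_natural_sum_nat
    by (metis One_nat_def Suc_1 not_less_eq_eq)
next
  case False
  then show ?thesis
    by (intro super_jacobsthal_natural_sum_infinite) simp
qed

end
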